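(* For every finite set $A$ of options, the projected scores and the rank-like rates depend continuously on the Llull matrix: for every pair $xy\in\Pi$ the map $\Omega\ni v\mapsto v^{\pi}_{xy}\in\mathbb{R}$ is continuous, and for every $x\in A$ the map $\Omega\ni v\mapsto R_x\in\mathbb{R}$ is continuous (with $\Omega\subset\mathbb{R}^{\Pi}$ carrying the Euclidean topology).
   Context: Let $A$ be a finite set of $N\ge 1$ options and $\Pi=\{(x,y)\in A\times A : x\neq y\}$; a pair $(x,y)$ is written $xy$. Let $\Omega=\{v\in[0,1]^{\Pi} : v_{xy}+v_{yx}\le 1 \text{ for all } xy\in\Pi\}$; its elements are called Llull matrices. For $v\in\Omega$ put $t_{xy}=v_{xy}+v_{yx}$ (turnouts). CLC procedure applied to $v\in\Omega$: (1) Indirect scores: $v^*_{xy}=\max\min_{0\le i<n} v_{x_ix_{i+1}}$, the maximum being over all paths $x_0x_1\dots x_n$ ($n\ge1$, consecutive elements distinct) in $A$ with $x_0=x$, $x_n=y$. Indirect margins: $m^{\kappa}_{xy}=v^*_{xy}-v^*_{yx}$. (2) Indirect comparison relation: $\kappa=\{xy\in\Pi : m^{\kappa}_{xy}>0\}$ (it is transitive). An admissible order is any strict total order $\xi\subseteq\Pi$ on $A$ with $\kappa\subseteq\xi$. Fix an admissible order $\xi$. Write $x\succ_\xi y$ for $xy\in\xi$, and $x\succeq_\xi y$ for ($xy\in\xi$ or $x=y$). For $x$ not last in $\xi$, $x'$ denotes the immediate successor of $x$ in $\xi$ (the element following $x$). (3) For each non-last $x$: $m^{\sigma}_{xx'}=\min\{m^{\kappa}_{pq}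 : p\succeq_\xi x,\ x'\succeq_\xi q\}$. (4) $(t^{\sigma}_{xy})$ is the unique minimizer of $\sum_{x}\sum_{y\neq x}(\tau_{xy}-t_{xy})^2$ over all $\tau\in\mathbb{R}^{\Pi}$ satisfying: $\tau_{xy}=\tau_{yx}$ for all $xy\in\Pi$; $m^{\sigma}_{xx'}\le\tau_{xx'}\le1$ for all non-last $x$; and $0\le\tau_{xz}-\tau_{x'z}\le m^{\sigma}_{xx'}$ for all non-last $x$ and all $z\notin\{x,x'\}$. (5) Projected scores: $v^{\pi}_{xx'}=(t^{\sigma}_{xx'}+m^{\sigma}_{xx'})/2$, $v^{\pi}_{x'x}=(t^{\sigma}_{xx'}-m^{\sigma}_{xx'})/2$, and for $x\succ_\xi y$: $v^{\pi}_{xy}=\max\{v^{\pi}_{pp'} : x\succeq_\xi p\succ_\xi y\}$, $v^{\pi}_{yx}=\min\{v^{\pi}_{p'p} : x\succeq_\xi p\succ_\xi y\}$. (6) Rank-like rates: $R_x=N-\sum_{y\neq x}v^{\pi}_{xy}$. The projected scores and rank-like rates do not depend on the choice of the admissible order $\xi$, so they are functions of $v$. *)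

theory Defs
  imports "HOL-Analysis.Analysis"
begin

text \<open>
  A point of the space of real vectors indexed by the pairs over \<open>A\<close> is a function on pairs
  that is extensional, i.e. \<open>undefined\<close> off \<open>pairs A\<close>; its topology is
  \<open>powertop_real (pairs A)\<close>, which for finite \<open>A\<close> is the Euclidean one.
\<close>

definition pairs :: "'a set \<Rightarrow> ('a \<times> 'a) set" where
  "pairs A = {(x, y). x \<in> A \<and> y \<in> A \<and> x \<noteq> y}"

definition llull :: "'a set \<Rightarrow> ('a \<times> 'a \<Rightarrow> real) set" where
  "llull A = {v \<in> pairs A \<rightarrow>\<^sub>E {0..1}. \<forall>(x, y) \<in> pairs A. v (x, y) + v (y, x) \<le> 1}"

definition turnout :: "('a \<times> 'a \<Rightarrow> real) \<Rightarrow> 'a \<Rightarrow> 'a \<Rightarrow> real" where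
  "turnout v x y = v (x, y) + v (y, x)"

text \<open>
  There are infinitely many paths from \<open>x\<close> to \<open>y\<close>, but their minima are values of \<open>v\<close> on
  \<open>pairs A\<close>, so the maximum is over a finite set when \<open>A\<close> is finite.
\<close>

definition indirect_score :: "'a set \<Rightarrow> ('a \<times> 'a \<Rightarrow> real) \<Rightarrow> 'a \<Rightarrow> 'a \<Rightarrow> real" where
  "indirect_score A v x y =
     Max {Min ((\<lambda>i. v (p i, p (Suc i))) ` {0..<n}) | n p.
            1 \<le> n \<and> p 0 = x \<and> p n = y \<and> (\<forall>i\<le>n. p i \<in> A) \<and> (\<forall>i<n. p i \<noteq> p (Suc i))}"

definition indirect_margin :: "'a set \<Rightarrow> ('a \<times> 'a \<Rightarrow> real) \<Rightarrow> 'a \<Rightarrow> 'a \<Rightarrow> real" where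
  "indirect_margin A v x y = indirect_score A v x y - indirect_score A v y x"

definition indirect_comparison :: "'a set \<Rightarrow> ('a \<times> 'a \<Rightarrow> real) \<Rightarrow> 'a rel" where
  "indirect_comparison A v = {(x, y) \<in> pairs A. indirect_margin A v x y > 0}"

text \<open>In an order \<open>\<xi>\<close>, \<open>(x, y) \<in> \<xi>\<close> means that \<open>x\<close> is preferred to \<open>y\<close>.\<close>

definition admissible :: "'a set \<Rightarrow> ('a \<times> 'a \<Rightarrow> real) \<Rightarrow> 'a rel \<Rightarrow> bool" where
  "admissible A v \<xi> \<longleftrightarrow>
     \<xi> \<subseteq> pairs A \<and> strict_linear_order_on A \<xi> \<and> indirect_comparison A v \<subseteq> \<xi>"

definition next_in :: "'a rel \<Rightarrow> 'a \<Rightarrow> 'a \<Rightarrow> bool" where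
  "next_in \<xi> x x' \<longleftrightarrow> (x, x') \<in> \<xi> \<and> \<not> (\<exists>z. (x, z) \<in> \<xi> \<and> (z, x') \<in> \<xi>)"

definition sigma_margin ::
    "'a set \<Rightarrow> ('a \<times> 'a \<Rightarrow> real) \<Rightarrow> 'a rel \<Rightarrow> 'a \<Rightarrow> 'a \<Rightarrow> real" where
  "sigma_margin A v \<xi> x x' =
     Min {indirect_margin A v p q | p q. (p, x) \<in> \<xi>\<^sup>= \<and> (x', q) \<in> \<xi>\<^sup>=}"

definition feasible_turnouts ::
    "'a set \<Rightarrow> ('a \<times> 'a \<Rightarrow> real) \<Rightarrow> 'a rel \<Rightarrow> ('a \<times> 'a \<Rightarrow> real) set" where
  "feasible_turnouts A v \<xi> = {\<tau> \<in> pairs A \<rightarrow>\<^sub>E UNIV.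
     (\<forall>(x, y) \<in> pairs A. \<tau> (x, y) = \<tau> (y, x)) \<and>
     (\<forall>x x'. next_in \<xi> x x' \<longrightarrow>
        sigma_margin A v \<xi> x x' \<le> \<tau> (x, x') \<and> \<tau> (x, x') \<le> 1 \<and>
        (\<forall>z \<in> A - {x, x'}. 0 \<le> \<tau> (x, z) - \<tau> (x', z) \<and>
           \<tau> (x, z) - \<tau> (x', z) \<le> sigma_margin A v \<xi> x x'))}"

definition sigma_turnout ::
    "'a set \<Rightarrow> ('a \<times> 'a \<Rightarrow> real) \<Rightarrow> 'a rel \<Rightarrow> 'a \<times> 'a \<Rightarrow> real" where
  "sigma_turnout A v \<xi> =
     (THE \<tau>. is_arg_min (\<lambda>\<tau>. \<Sum>x\<in>A. \<Sum>y\<in>A - {x}. (\<tau> (x, y) - turnout v x y)\<^sup>2)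
               (\<lambda>\<tau>. \<tau> \<in> feasible_turnouts A v \<xi>) \<tau>)"

definition upper_score ::
    "'a set \<Rightarrow> ('a \<times> 'a \<Rightarrow> real) \<Rightarrow> 'a rel \<Rightarrow> 'a \<Rightarrow> 'a \<Rightarrow> real" where
  "upper_score A v \<xi> x x' = (sigma_turnout A v \<xi> (x, x') + sigma_margin A v \<xi> x x') / 2"

definition lower_score ::
    "'a set \<Rightarrow> ('a \<times> 'a \<Rightarrow> real) \<Rightarrow> 'a rel \<Rightarrow> 'a \<Rightarrow> 'a \<Rightarrow> real" where
  "lower_score A v \<xi> x x' = (sigma_turnout A v \<xi> (x, x') - sigma_margin A v \<xi> x x') / 2"

text \<open>
  When \<open>x\<close> and \<open>y\<close> are consecutive in \<open>\<xi>\<close>, the maximum and minimum below range over the single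
  pair they form, so consecutive pairs need no separate clause.
\<close>

definition projected_score_wrt ::
    "'a set \<Rightarrow> ('a \<times> 'a \<Rightarrow> real) \<Rightarrow> 'a rel \<Rightarrow> 'a \<Rightarrow> 'a \<Rightarrow> real" where
  "projected_score_wrt A v \<xi> x y =
     (if (x, y) \<in> \<xi>
      then Max {upper_score A v \<xi> p p' | p p'. next_in \<xi> p p' \<and> (x, p) \<in> \<xi>\<^sup>= \<and> (p, y) \<in> \<xi>}
      else Min {lower_score A v \<xi> p p' | p p'. next_in \<xi> p p' \<and> (y, p) \<in> \<xi>\<^sup>= \<and> (p, x) \<in> \<xi>})"

text \<open>
  The scores do not depend on the admissible order, so it does not matter which one is chosen.
\<close>

definition projected_score :: "'a set \<Rightarrow> ('a \<times> 'a \<Rightarrow> real) \<Rightarrow> 'a \<Rightarrow> 'a \<Rightarrow> real" where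
  "projected_score A v = projected_score_wrt A v (SOME \<xi>. admissible A v \<xi>)"

definition rank_rate :: "'a set \<Rightarrow> ('a \<times> 'a \<Rightarrow> real) \<Rightarrow> 'a \<Rightarrow> real" where
  "rank_rate A v x = real (card A) - (\<Sum>y\<in>A - {x}. projected_score A v x y)"

end

theory Submission
  imports Defs
begin

text \<open>
  The matrices that admit a fixed order \<open>\<xi>\<close> are cut out by the conditions that the indirect
  margins be nonnegative on \<open>\<xi>\<close>, and the indirect scores are max-min expressions in the
  entries. So the Llull matrices are covered by finitely many closed sets, and it suffices to have
  continuity on each of them and agreement on the overlaps.

  For a fixed order only the least-squares projection is delicate, because its feasible set moves.
  Minimisers stay bounded, limits of feasible points are feasible, and every feasible point is a
  limit of points feasible for the nearby matrices; hence every cluster point of the minimisers is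
  the minimiser.

  Two admissible orders are connected by transpositions of neighbours \<open>a\<close>, \<open>b\<close> with vanishing
  margin. Then the step from \<open>a\<close> to \<open>b\<close> has margin 0, which forces feasible turnouts to treat
  \<open>a\<close> and \<open>b\<close> alike, so the transposition changes neither the feasible set nor the scores.
\<close>

section \<open>Limits and least-squares projections\<close>

text \<open>The obstacle is that the feasible set must not shrink abruptly near a matrix. Where a
  step margin vanishes, the difference constraints become equations, so there is no interior point
  to perturb from. What helps is that all bounds are affine in the step margins and that the
  constant turnout 1 is feasible for any step margins in [0,1]. Convergence is stated for a family
  \<open>V\<close> along an arbitrary filter: cluster points become limits along finer filters, and
  the same lemmas serve for closedness, for restriction to the matrices admitting one order, and for
  the final topology, of which only coordinatewise convergence is used. A transposition of
  neighbours is treated in two halves. Exchanging the labels in the order exchanges the labels in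
  the scores, because corresponding steps have equal margins and turnouts. Exchanging the labels in
  the scores of one order changes nothing: the step of margin 0 has equal upper and lower score, and
  this value lies between the lower and the upper score of the neighbouring step.\<close>

lemma tendsto_Max_image:
  fixes l :: "'i \<Rightarrow> 'b::linorder_topology"
  assumes "finite I" "I \<noteq> {}" and "\<And>i. i \<in> I \<Longrightarrow> ((\<lambda>v. f v i) \<longlongrightarrow> l i) F"
  shows "((\<lambda>v. Max (f v ` I)) \<longlongrightarrow> Max (l ` I)) F"
  using assms by (induction I rule: finite_ne_induct) (auto intro!: tendsto_max)

lemma tendsto_Min_image:
  fixes l :: "'i \<Rightarrow> 'b::linorder_topology"
  assumes "finite I" "I \<noteq> {}" and "\<And>i. i \<in> I \<Longrightarrow> ((\<lambda>v. f v i) \<longlongrightarrow> l i) F"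
  shows "((\<lambda>v. Min (f v ` I)) \<longlongrightarrow> Min (l ` I)) F"
  using assms by (induction I rule: finite_ne_induct) (auto intro!: tendsto_min)

text \<open>Holds at every index, also outside the domain of an extensional function; this lets the
  value \<open>undefined\<close> pass to a limit.\<close>

lemma tendsto_fun_apply:
  fixes c :: "'i \<Rightarrow> 'b::topological_space"
  assumes "(f \<longlongrightarrow> c) F"
  shows "((\<lambda>v. f v i) \<longlongrightarrow> c i) F"
proof (rule topological_tendstoI)
  fix S :: "'b set" assume S: "open S" "c i \<in> S"
  have "open {x::'i \<Rightarrow> 'b. x i \<in> S}"
    using product_topology_basis'[of "{()}" "\<lambda>_. S" "\<lambda>_. i"] S by simp
  then show "eventually (\<lambda>v. f v i \<in> S) F"
    using topological_tendstoD[OF assms] S by fastforce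
qed

text \<open>Finer filters replace subsequences. If \<open>f\<close> kept missing a neighbourhood of
  \<open>l\<close>, compactness would give a cluster point \<open>c\<close> of those missing values,
  and \<open>unique\<close> would identify it with \<open>l\<close>.\<close>

lemma tendsto_if_unique_cluster_point:
  fixes f :: "'v \<Rightarrow> 'b::topological_space"
  assumes "compact U" and ev: "eventually (\<lambda>v. f v \<in> U) F"
    and unique: "\<And>F' c. F' \<le> F \<Longrightarrow> F' \<noteq> bot \<Longrightarrow> (f \<longlongrightarrow> c) F' \<Longrightarrow> c = l"
  shows "(f \<longlongrightarrow> l) F"
proof (rule topological_tendstoI, rule ccontr)
  fix S assume S: "open S" "l \<in> S" and not: "\<not> eventually (\<lambda>v. f v \<in> S) F"
  define F1 where "F1 = inf F (principal {v. f v \<notin> S})"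
  have "F1 \<noteq> bot"
    using not by (auto simp: F1_def trivial_limit_def eventually_inf_principal)
  moreover have "eventually (\<lambda>y. y \<in> U) (filtermap f F1)"
    using ev by (simp add: eventually_filtermap F1_def eventually_inf_principal eventually_mono)
  ultimately obtain c where c: "inf (nhds c) (filtermap f F1) \<noteq> bot"
    using \<open>compact U\<close> unfolding compact_filter by (metis filtermap_bot_iff)
  \<comment> \<open>Adding the preimages of the neighbourhoods of \<open>c\<close> turns the cluster
    point into a limit along a finer filter.\<close>
  define F2 where "F2 = inf F1 (filtercomap f (nhds c))"
  have F2: "F2 \<noteq> bot"
  proof
    assume "F2 = bot"
    then obtain P Q where P: "eventually P F1" and Q: "eventually Q (filtercomap f (nhds c))"
      and PQ: "\<And>v. P v \<and> Q v \<Longrightarrow> False"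
      unfolding F2_def trivial_limit_def eventually_inf by blast
    obtain R where R: "eventually R (nhds c)" "\<And>v. R (f v) \<Longrightarrow> Q v"
      using Q unfolding eventually_filtercomap by blast
    have "eventually (\<lambda>y. \<not> R y) (filtermap f F1)"
      unfolding eventually_filtermap using P by (rule eventually_mono) (use PQ R(2) in blast)
    then have "inf (nhds c) (filtermap f F1) = bot"
      unfolding trivial_limit_def eventually_inf using R(1) by blast
    with c show False ..
  qed
  have "(f \<longlongrightarrow> c) F2"
    unfolding F2_def filterlim_iff_le_filtercomap by simp
  moreover have "F2 \<le> F1" "F1 \<le> F"
    unfolding F1_def F2_def by (rule inf_le1)+
  ultimately have "c = l" and "(f \<longlongrightarrow> l) F2"
    using unique[of F2 c] F2 by auto
  then have "eventually (\<lambda>v. f v \<in> S) F2"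
    using S by (simp add: topological_tendstoD)
  moreover have "eventually (\<lambda>v. f v \<notin> S) F2"
    using \<open>F2 \<le> F1\<close> by (simp add: F1_def le_principal)
  ultimately have "eventually (\<lambda>v. False) F2"
    by eventually_elim simp
  with F2 show False
    by (simp add: trivial_limit_def)
qed

text \<open>For \<open>x\<close> outside \<open>K\<close>, the neighbourhood filter restricted to
  \<open>K\<close> must be trivial, or the assumption would put \<open>x\<close> into
  \<open>K\<close>. This form lets one limit lemma serve for fixed and for moving feasible
  sets.\<close>

lemma closed_if_contains_filter_limits:
  fixes K :: "'b::topological_space set"
  assumes "\<And>F x. F \<noteq> bot \<Longrightarrow> eventually (\<lambda>y. y \<in> K) F \<Longrightarrow> ((\<lambda>y. y) \<longlongrightarrow> x) F \<Longrightarrow> x \<in> K"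
  shows "closed K"
proof -
  have "\<exists>T. open T \<and> x \<in> T \<and> T \<subseteq> - K" if "x \<notin> K" for x
  proof -
    have "inf (nhds x) (principal K) = bot"
      using assms[of "inf (nhds x) (principal K)" x] that
      by (auto simp: eventually_inf_principal filterlim_def)
    then have "eventually (\<lambda>y. y \<notin> K) (nhds x)"
      by (simp add: trivial_limit_def eventually_inf_principal)
    then show ?thesis
      by (auto simp: eventually_nhds)
  qed
  then show ?thesis
    unfolding closed_def by (subst open_subopen) auto
qed

text \<open>Off \<open>I\<close> an extensional function has only the value
  \<open>undefined\<close>, so the box is a product over all indices with singleton factors there,
  and Tychonoff's theorem applies.\<close>

lemma compact_PiE_box:
  fixes a b :: "'i \<Rightarrow> real"
  shows "compact (PiE I (\<lambda>p. {a p..b p}))"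
proof -
  have "PiE I (\<lambda>p. {a p..b p}) = PiE UNIV (\<lambda>p. if p \<in> I then {a p..b p} else {undefined})"
    by (auto simp: PiE_iff extensional_def split: if_splits)
  moreover have "compactin (product_topology (\<lambda>_. euclidean) UNIV)
      (PiE UNIV (\<lambda>p. if p \<in> I then {a p..b p} else {undefined}))"
    by (simp add: compactin_PiE)
  ultimately show ?thesis
    by (simp add: euclidean_product_topology)
qed

section \<open>Least-squares minimisers: existence, uniqueness, dependence on data\<close>

lemma abs_diff_le_if_sum_squares_le:
  fixes \<tau> t :: "'i \<Rightarrow> real"
  assumes "finite I" "p \<in> I" and "(\<Sum>p\<in>I. (\<tau> p - t p)\<^sup>2) \<le> B\<^sup>2" "0 \<le> B"
  shows "\<bar>\<tau> p - t p\<bar> \<le> B"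
proof -
  have "(\<tau> p - t p)\<^sup>2 \<le> (\<Sum>p\<in>I. (\<tau> p - t p)\<^sup>2)"
    using assms by (intro member_le_sum) auto
  then have "(\<tau> p - t p)\<^sup>2 \<le> B\<^sup>2"
    using assms by linarith
  then show ?thesis
    using \<open>0 \<le> B\<close> by (simp flip: abs_le_square_iff)
qed

text \<open>Existence: points no worse than \<open>g\<close> stay within \<open>sqrt (J g)\<close>
  of \<open>t\<close> in every coordinate, which leaves a compact set. Uniqueness: the square is
  strictly convex, and closure of \<open>K\<close> under midpoints is enough to exploit it.\<close>

lemma ex1_least_squares:
  fixes t :: "'i \<Rightarrow> real"
  assumes I: "finite I" and K: "K \<subseteq> I \<rightarrow>\<^sub>E UNIV" and "g \<in> K" and "closed K"
    and mid: "\<And>r s. r \<in> K \<Longrightarrow> s \<in> K \<Longrightarrow> (\<lambda>p\<in>I. (r p + s p) / 2) \<in> K"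
  shows "\<exists>!\<tau>. is_arg_min (\<lambda>\<tau>. \<Sum>p\<in>I. (\<tau> p - t p)\<^sup>2) (\<lambda>\<tau>. \<tau> \<in> K) \<tau>"
proof -
  define J where "J = (\<lambda>\<tau>. \<Sum>p\<in>I. (\<tau> p - t p)\<^sup>2)"
  define B where "B = sqrt (J g)"
  have "0 \<le> J g"
    by (simp add: J_def sum_nonneg)
  then have B: "0 \<le> B" "J g = B\<^sup>2"
    by (simp_all add: B_def)
  define U where "U = K \<inter> PiE I (\<lambda>p. {t p - B..t p + B})"
  have inU: "\<tau> \<in> U" if "\<tau> \<in> K" "J \<tau> \<le> J g" for \<tau>
  proof -
    have "\<bar>\<tau> p - t p\<bar> \<le> B" if "p \<in> I" for p
      using that \<open>J \<tau> \<le> J g\<close> I B by (intro abs_diff_le_if_sum_squares_le) (auto simp: J_def)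
    then show ?thesis
      using that(1) K by (auto simp: U_def PiE_iff abs_le_iff algebra_simps)
  qed
  have "compact U"
    unfolding U_def using \<open>closed K\<close> compact_PiE_box by (rule closed_Int_compact)
  moreover have "U \<noteq> {}"
    using inU \<open>g \<in> K\<close> by auto
  moreover have "continuous_on U J"
  proof -
    have "continuous_on U (\<lambda>\<tau>. \<tau> p)" for p
      using continuous_on_subset[OF continuous_on_product_coordinates subset_UNIV] .
    then show ?thesis
      unfolding J_def by (intro continuous_intros)
  qed
  ultimately have "\<exists>m\<in>U. \<forall>y\<in>U. J m \<le> J y"
    by (rule continuous_attains_inf)
  then obtain m where m: "m \<in> U" "\<And>y. y \<in> U \<Longrightarrow> J m \<le> J y"
    by blast
  have exists: "is_arg_min J (\<lambda>\<tau>. \<tau> \<in> K) m"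
    unfolding is_arg_min_linorder
  proof (intro conjI allI impI)
    show "m \<in> K"
      using m by (simp add: U_def)
    show "J m \<le> J y" if "y \<in> K" for y
      using m(2)[OF inU[OF that]] m(2)[OF inU[OF \<open>g \<in> K\<close>]] by linarith
  qed
  have unique: "r = s" if r: "is_arg_min J (\<lambda>\<tau>. \<tau> \<in> K) r" and s: "is_arg_min J (\<lambda>\<tau>. \<tau> \<in> K) s"
    for r s
  proof -
    have rs: "r \<in> K" "s \<in> K" "J r = J s"
      using r s by (auto simp: is_arg_min_linorder intro: antisym)
    have "J r \<le> J (\<lambda>p\<in>I. (r p + s p) / 2)"
      using r mid[OF rs(1,2)] by (simp add: is_arg_min_linorder)
    \<comment> \<open>Parallelogram identity: the midpoint of two minimisers would beat them by a
      quarter of their squared distance.\<close>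
    also have "\<dots> = (\<Sum>p\<in>I. (r p - t p)\<^sup>2 / 2 + (s p - t p)\<^sup>2 / 2 - (r p - s p)\<^sup>2 / 4)"
      unfolding J_def by (intro sum.cong) (auto simp: power2_eq_square field_simps)
    also have "\<dots> = J r / 2 + J s / 2 - (\<Sum>p\<in>I. (r p - s p)\<^sup>2) / 4"
      by (simp add: J_def sum.distrib sum_subtractf sum_divide_distrib)
    finally have "(\<Sum>p\<in>I. (r p - s p)\<^sup>2) \<le> 0"
      using rs by simp
    then have "(\<Sum>p\<in>I. (r p - s p)\<^sup>2) = 0"
      by (simp add: antisym sum_nonneg)
    then have "\<forall>p\<in>I. r p = s p"
      using I by (simp add: sum_nonneg_eq_0_iff)
    then show ?thesis
      using rs K by (intro PiE_ext[of r I "\<lambda>_. UNIV" s]) auto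
  qed
  have "\<exists>!\<tau>. is_arg_min J (\<lambda>\<tau>. \<tau> \<in> K) \<tau>"
  proof
    show "is_arg_min J (\<lambda>\<tau>. \<tau> \<in> K) m"
      by (fact exists)
    show "r = m" if "is_arg_min J (\<lambda>\<tau>. \<tau> \<in> K) r" for r
      using unique[OF that exists] .
  qed
  then show ?thesis
    by (simp only: J_def)
qed

text \<open>The family \<open>g\<close> has to approach only the limit minimiser \<open>f0\<close>.
  As \<open>f v\<close> does at least as well as \<open>g v\<close>, a limit \<open>c\<close> of the
  minimisers does at least as well as \<open>f0\<close>; by \<open>upper\<close> it is a competitor
  in \<open>K0\<close>, so \<open>unique0\<close> applies. The uniform bound \<open>B\<close>
  supplies the compact box.\<close>

lemma least_squares_tendsto:
  fixes t :: "'v \<Rightarrow> 'i \<Rightarrow> real"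
  assumes I: "finite I"
    and min: "eventually (\<lambda>v. is_arg_min (\<lambda>\<tau>. \<Sum>p\<in>I. (\<tau> p - t v p)\<^sup>2) (\<lambda>\<tau>. \<tau> \<in> K v) (f v)) F"
    and ext: "eventually (\<lambda>v. f v \<in> I \<rightarrow>\<^sub>E {-B..B}) F"
    and min0: "is_arg_min (\<lambda>\<tau>. \<Sum>p\<in>I. (\<tau> p - t0 p)\<^sup>2) (\<lambda>\<tau>. \<tau> \<in> K0) f0"
    and unique0: "\<And>c. is_arg_min (\<lambda>\<tau>. \<Sum>p\<in>I. (\<tau> p - t0 p)\<^sup>2) (\<lambda>\<tau>. \<tau> \<in> K0) c \<Longrightarrow> c = f0"
    and t: "\<And>p. p \<in> I \<Longrightarrow> ((\<lambda>v. t v p) \<longlongrightarrow> t0 p) F"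
    and upper: "\<And>F' c. F' \<le> F \<Longrightarrow> F' \<noteq> bot \<Longrightarrow> (f \<longlongrightarrow> c) F' \<Longrightarrow> c \<in> K0"
    and lower: "eventually (\<lambda>v. g v \<in> K v) F" "\<And>p. p \<in> I \<Longrightarrow> ((\<lambda>v. g v p) \<longlongrightarrow> f0 p) F"
  shows "(f \<longlongrightarrow> f0) F"
proof (rule tendsto_if_unique_cluster_point[OF compact_PiE_box ext])
  fix F' c assume le: "F' \<le> F" and nbot: "F' \<noteq> bot" and c: "(f \<longlongrightarrow> c) F'"
  have "((\<lambda>v. \<Sum>p\<in>I. (f v p - t v p)\<^sup>2) \<longlongrightarrow> (\<Sum>p\<in>I. (c p - t0 p)\<^sup>2)) F'"
    by (intro tendsto_intros tendsto_fun_apply[OF c] tendsto_mono[OF le t])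
  moreover have "((\<lambda>v. \<Sum>p\<in>I. (g v p - t v p)\<^sup>2) \<longlongrightarrow> (\<Sum>p\<in>I. (f0 p - t0 p)\<^sup>2)) F'"
    by (intro tendsto_intros tendsto_mono[OF le lower(2)] tendsto_mono[OF le t])
  moreover have "eventually (\<lambda>v. (\<Sum>p\<in>I. (f v p - t v p)\<^sup>2) \<le> (\<Sum>p\<in>I. (g v p - t v p)\<^sup>2)) F"
    using min lower(1) by eventually_elim (auto simp: is_arg_min_linorder)
  ultimately have "(\<Sum>p\<in>I. (c p - t0 p)\<^sup>2) \<le> (\<Sum>p\<in>I. (f0 p - t0 p)\<^sup>2)"
    using nbot filter_leD[OF le] by (auto intro: tendsto_le)
  then show "c = f0"
    using upper[OF le nbot c] min0
    by (intro unique0) (auto simp: is_arg_min_linorder intro: order_trans)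
qed

section \<open>Indirect scores\<close>

text \<open>The minimum along a path depends only on its edge set, a subset of
  \<open>pairs A\<close>. So infinitely many paths reduce to a finite index set that is the same for
  all matrices.\<close>

definition path_edge_sets :: "'a set \<Rightarrow> 'a \<Rightarrow> 'a \<Rightarrow> ('a \<times> 'a) set set" where
  "path_edge_sets A x y = {(\<lambda>i. (p i, p (Suc i))) ` {0..<n} | n p.
     1 \<le> n \<and> p 0 = x \<and> p n = y \<and> (\<forall>i\<le>n. p i \<in> A) \<and> (\<forall>i<n. p i \<noteq> p (Suc i))}"

lemma indirect_score_eq:
  "indirect_score A v x y = Max ((\<lambda>S. Min (v ` S)) ` path_edge_sets A x y)"
proof -
  have "f ` {h n p | n p. P n p} = {f (h n p) | n p. P n p}"
    for f :: "('a \<times> 'a) set \<Rightarrow> real" and h :: "nat \<Rightarrow> (nat \<Rightarrow> 'a) \<Rightarrow> ('a \<times> 'a) set" and P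
    by blast
  then show ?thesis
    by (simp add: indirect_score_def path_edge_sets_def image_image)
qed

lemma finite_pairs: "finite A \<Longrightarrow> finite (pairs A)"
  by (rule finite_subset[of _ "A \<times> A"]) (auto simp: pairs_def)

lemma path_edge_sets_subset: "S \<in> path_edge_sets A x y \<Longrightarrow> S \<subseteq> pairs A"
  by (auto simp: path_edge_sets_def pairs_def)

lemma path_edge_sets_nonempty: "S \<in> path_edge_sets A x y \<Longrightarrow> S \<noteq> {}"
  by (auto simp: path_edge_sets_def)

lemma finite_path_edge_sets: "finite A \<Longrightarrow> finite (path_edge_sets A x y)"
  using path_edge_sets_subset[of _ A x y] finite_pairs[of A]
  by (intro finite_subset[of "path_edge_sets A x y" "Pow (pairs A)"]) auto

lemma edge_in_path_edge_sets:
  assumes "(x, y) \<in> pairs A"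
  shows "{(x, y)} \<in> path_edge_sets A x y"
  unfolding path_edge_sets_def
  by (rule CollectI, rule exI[of _ 1], rule exI[of _ "\<lambda>i. if i = 0 then x else y"])
    (use assms in \<open>simp add: pairs_def\<close>)

lemma path_edge_sets_append:
  assumes "S \<in> path_edge_sets A x y" "T \<in> path_edge_sets A y z"
  shows "S \<union> T \<in> path_edge_sets A x z"
proof -
  obtain n p where p: "S = (\<lambda>i. (p i, p (Suc i))) ` {0..<n}" "1 \<le> n" "p 0 = x" "p n = y"
    "\<And>i. i \<le> n \<Longrightarrow> p i \<in> A" "\<And>i. i < n \<Longrightarrow> p i \<noteq> p (Suc i)"
    using assms(1) unfolding path_edge_sets_def by blast
  obtain m q where q: "T = (\<lambda>i. (q i, q (Suc i))) ` {0..<m}" "1 \<le> m" "q 0 = y" "q m = z"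
    "\<And>i. i \<le> m \<Longrightarrow> q i \<in> A" "\<And>i. i < m \<Longrightarrow> q i \<noteq> q (Suc i)"
    using assms(2) unfolding path_edge_sets_def by blast
  define r where "r i = (if i \<le> n then p i else q (i - n))" for i
  have r1: "r i = p i" if "i \<le> n" for i
    using that by (simp add: r_def)
  \<comment> \<open>At \<open>i = 0\<close> the first branch of \<open>r\<close> applies; the two
    paths meet there in \<open>y\<close>.\<close>
  have r2: "r (n + i) = q i" for i
    using p(4) q(3) by (cases i) (auto simp: r_def)
  have "(\<lambda>i. (r i, r (Suc i))) ` {0..<n + m} = S \<union> T"
  proof -
    have "{0..<n + m} = {0..<n} \<union> (+) n ` {0..<m}"
      by (auto simp: image_iff)
    moreover have "(\<lambda>i. (r i, r (Suc i))) ` {0..<n} = S"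
      by (auto simp: p(1) r1 intro!: image_cong)
    moreover have "(\<lambda>i. (r i, r (Suc i))) ` (+) n ` {0..<m} = T"
      unfolding image_image q(1) by (intro image_cong) (auto simp: r2 simp flip: add_Suc_right)
    ultimately show ?thesis
      by (simp add: image_Un)
  qed
  moreover have "r i \<in> A" if "i \<le> n + m" for i
    using that p(5) q(5) by (auto simp: r_def)
  moreover have "r i \<noteq> r (Suc i)" if "i < n + m" for i
  proof (cases "i < n")
    case True
    then show ?thesis
      using p(6) by (simp add: r1)
  next
    case False
    then obtain j where "i = n + j"
      using le_Suc_ex not_less by blast
    then show ?thesis
      using that q(6)[of j] r2[of j] r2[of "Suc j"] by simp
  qed
  moreover have "r 0 = x" "r (n + m) = z" "1 \<le> n + m"
    using p q r1[of 0] r2[of m] by auto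
  ultimately show ?thesis
    unfolding path_edge_sets_def by (intro CollectI exI[of _ "n + m"] exI[of _ r]) auto
qed

lemma indirect_score_attained:
  assumes "finite A" "(x, y) \<in> pairs A"
  obtains S where "S \<in> path_edge_sets A x y" "indirect_score A v x y = Min (v ` S)"
proof -
  have "indirect_score A v x y \<in> (\<lambda>S. Min (v ` S)) ` path_edge_sets A x y"
    unfolding indirect_score_eq
    using finite_path_edge_sets[OF assms(1), of x y] edge_in_path_edge_sets[OF assms(2)]
    by (intro Max_in) auto
  then show ?thesis
    using that by blast
qed

lemma Min_le_indirect_score:
  assumes "finite A" "S \<in> path_edge_sets A x y"
  shows "Min (v ` S) \<le> indirect_score A v x y"
  unfolding indirect_score_eq using assms by (intro Max_ge) (auto simp: finite_path_edge_sets)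

lemma finite_path_edge_set: "finite A \<Longrightarrow> S \<in> path_edge_sets A x y \<Longrightarrow> finite S"
  by (rule finite_subset[OF path_edge_sets_subset finite_pairs])

text \<open>Concatenating an optimal path to \<open>y\<close> with one from \<open>y\<close> gives a
  competitor whose weakest edge is the weaker of the two.\<close>

lemma indirect_score_triangle:
  assumes "finite A" "(x, y) \<in> pairs A" "(y, z) \<in> pairs A"
  shows "min (indirect_score A v x y) (indirect_score A v y z) \<le> indirect_score A v x z"
proof -
  obtain S where S: "S \<in> path_edge_sets A x y" "indirect_score A v x y = Min (v ` S)"
    by (rule indirect_score_attained[OF assms(1,2)])
  obtain T where T: "T \<in> path_edge_sets A y z" "indirect_score A v y z = Min (v ` T)"
    by (rule indirect_score_attained[OF assms(1,3)])
  have "min (Min (v ` S)) (Min (v ` T)) = Min (v ` (S \<union> T))"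
    using finite_path_edge_set[OF assms(1)] path_edge_sets_nonempty[OF S(1)]
      path_edge_sets_nonempty[OF T(1)] S(1) T(1)
    by (auto simp: image_Un Min_Un)
  also have "\<dots> \<le> indirect_score A v x z"
    by (intro Min_le_indirect_score[OF assms(1)] path_edge_sets_append[OF S(1) T(1)])
  finally show ?thesis
    using S T by simp
qed

section \<open>Continuity, bounds and transitivity for the indirect margins\<close>

lemma indirect_score_tendsto:
  assumes "finite A" "(x, y) \<in> pairs A" and v: "\<And>p. p \<in> pairs A \<Longrightarrow> ((\<lambda>w. V w p) \<longlongrightarrow> v p) F"
  shows "((\<lambda>w. indirect_score A (V w) x y) \<longlongrightarrow> indirect_score A v x y) F"
  unfolding indirect_score_eq
proof (rule tendsto_Max_image)
  show "finite (path_edge_sets A x y)" "path_edge_sets A x y \<noteq> {}"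
    using finite_path_edge_sets[OF assms(1), of x y] edge_in_path_edge_sets[OF assms(2)] by auto
  show "((\<lambda>w. Min (V w ` S)) \<longlongrightarrow> Min (v ` S)) F" if S: "S \<in> path_edge_sets A x y" for S
    using path_edge_sets_nonempty[OF S] path_edge_sets_subset[OF S] finite_path_edge_set[OF assms(1) S]
    by (intro tendsto_Min_image v) auto
qed

lemma indirect_margin_tendsto:
  assumes "finite A" "(x, y) \<in> pairs A" and v: "\<And>p. p \<in> pairs A \<Longrightarrow> ((\<lambda>w. V w p) \<longlongrightarrow> v p) F"
  shows "((\<lambda>w. indirect_margin A (V w) x y) \<longlongrightarrow> indirect_margin A v x y) F"
  unfolding indirect_margin_def
  using assms by (intro tendsto_diff indirect_score_tendsto) (auto simp: pairs_def)

text \<open>Scores are entries of \<open>v\<close>, hence lie in [0,1]. The bound matters because it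
  makes the turnout constant 1 feasible.\<close>

lemma indirect_margin_le_1:
  assumes "finite A" "(x, y) \<in> pairs A" "v \<in> llull A"
  shows "indirect_margin A v x y \<le> 1"
proof -
  have "indirect_score A v p q \<in> {0..1}" if pq: "(p, q) \<in> pairs A" for p q
  proof -
    obtain S where S: "S \<in> path_edge_sets A p q" "indirect_score A v p q = Min (v ` S)"
      by (rule indirect_score_attained[OF assms(1) pq])
    have "Min (v ` S) \<in> v ` S"
      using S assms by (intro Min_in) (auto simp: finite_path_edge_set path_edge_sets_nonempty)
    moreover have "v ` S \<subseteq> {0..1}"
      using path_edge_sets_subset[OF S(1)] assms(3) by (auto simp: llull_def PiE_iff)
    ultimately show ?thesis
      using S by auto
  qed
  from this[of x y] this[of y x] show ?thesis
    using assms by (auto simp: indirect_margin_def pairs_def)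
qed

text \<open>Needed for the existence of an admissible order: without transitivity the relation might
  extend to no total order.\<close>

lemma trans_indirect_comparison:
  assumes "finite A"
  shows "trans (indirect_comparison A v)"
proof (rule transI)
  fix x y z assume "(x, y) \<in> indirect_comparison A v" "(y, z) \<in> indirect_comparison A v"
  then have xyz: "(x, y) \<in> pairs A" "(y, z) \<in> pairs A"
    "indirect_score A v x y > indirect_score A v y x" "indirect_score A v y z > indirect_score A v z y"
    by (auto simp: indirect_comparison_def indirect_margin_def)
  then have "x \<noteq> z"
    by auto
  with xyz have p: "(y, x) \<in> pairs A" "(z, y) \<in> pairs A" "(x, z) \<in> pairs A" "(z, x) \<in> pairs A"
    by (auto simp: pairs_def)
  note t = indirect_score_triangle[OF assms, of _ _ _ v]
  \<comment> \<open>Otherwise the score of \<open>z\<close> over \<open>x\<close> is at least the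
    smaller of those of \<open>x\<close> over \<open>y\<close> and of \<open>y\<close> over
    \<open>z\<close>. If the former is the smaller one, the triangle through \<open>z\<close> bounds
    it by that of \<open>y\<close> over \<open>x\<close>; if the latter, the triangle through
    \<open>x\<close> bounds it by that of \<open>z\<close> over \<open>y\<close>. Both are
    excluded.\<close>
  have "indirect_score A v x z > indirect_score A v z x"
    using t[OF xyz(1,2)] t[OF xyz(2) p(4)] t[OF p(4) xyz(1)] xyz(3,4)
    by (auto simp: min_def split: if_splits)
  then show "(x, z) \<in> indirect_comparison A v"
    using p by (simp add: indirect_comparison_def indirect_margin_def)
qed

text \<open>
  An admissible order ranks options by the number of options they beat in the indirect
  comparison relation, breaking ties by an enumeration of \<open>A\<close>.
\<close>

lemma admissible_exists:
  assumes "finite A"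
  shows "\<exists>\<xi>. admissible A v \<xi>"
proof -
  define \<kappa> where "\<kappa> = indirect_comparison A v"
  define f where "f x = card {z \<in> A. (x, z) \<in> \<kappa>}" for x
  obtain g :: "'a \<Rightarrow> nat" where g: "inj_on g A"
    using finite_imp_inj_to_nat_seg[OF assms] by blast
  define \<xi> where "\<xi> = {(x, y) \<in> pairs A. f y < f x \<or> f y = f x \<and> g x < g y}"
  have "f y < f x" if "(x, y) \<in> \<kappa>" for x y
  proof -
    have "{z \<in> A. (y, z) \<in> \<kappa>} \<subset> {z \<in> A. (x, z) \<in> \<kappa>}"
    proof
      show "{z \<in> A. (y, z) \<in> \<kappa>} \<subseteq> {z \<in> A. (x, z) \<in> \<kappa>}"
        using that trans_indirect_comparison[OF assms, of v] by (auto simp: \<kappa>_def dest: transD)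
      have "y \<in> A" "(y, y) \<notin> \<kappa>"
        using that by (auto simp: \<kappa>_def indirect_comparison_def pairs_def)
      then show "{z \<in> A. (y, z) \<in> \<kappa>} \<noteq> {z \<in> A. (x, z) \<in> \<kappa>}"
        using that by blast
    qed
    then show ?thesis
      unfolding f_def using assms by (intro psubset_card_mono) auto
  qed
  then have "\<kappa> \<subseteq> \<xi>"
    by (auto simp: \<xi>_def \<kappa>_def indirect_comparison_def)
  moreover have "trans \<xi>"
    by (rule transI) (auto simp: \<xi>_def pairs_def)
  moreover have "irrefl \<xi>"
    by (rule irreflI) (auto simp: \<xi>_def)
  moreover have "total_on A \<xi>"
  proof (rule total_onI)
    fix x y assume "x \<in> A" "y \<in> A" "x \<noteq> y"
    moreover from this have "g x \<noteq> g y"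
      using g by (auto dest: inj_onD)
    ultimately show "(x, y) \<in> \<xi> \<or> (y, x) \<in> \<xi>"
      by (auto simp: \<xi>_def pairs_def)
  qed
  ultimately show ?thesis
    by (intro exI[of _ \<xi>]) (auto simp: admissible_def strict_linear_order_on_def \<kappa>_def \<xi>_def)
qed

section \<open>Admissible orders\<close>

text \<open>No matrix occurs here: the order stays fixed while the matrix varies, and admissibility
  is a separate condition on the matrix.\<close>

locale finite_order =
  fixes A :: "'a set" and \<xi> :: "'a rel"
  assumes finite_A: "finite A" and subset_pairs: "\<xi> \<subseteq> pairs A"
    and strict_linear: "strict_linear_order_on A \<xi>"
begin

lemma in_A: "(x, y) \<in> \<xi> \<Longrightarrow> x \<in> A \<and> y \<in> A \<and> x \<noteq> y"
  using subset_pairs by (auto simp: pairs_def)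

lemma order_trans: "(x, y) \<in> \<xi> \<Longrightarrow> (y, z) \<in> \<xi> \<Longrightarrow> (x, z) \<in> \<xi>"
  using strict_linear by (auto simp: strict_linear_order_on_def dest: transD)

lemma order_asym: "(x, y) \<in> \<xi> \<Longrightarrow> (y, x) \<notin> \<xi>"
  using order_trans[of x y x] in_A by blast

lemma order_total: "x \<in> A \<Longrightarrow> y \<in> A \<Longrightarrow> x \<noteq> y \<Longrightarrow> (x, y) \<in> \<xi> \<or> (y, x) \<in> \<xi>"
  using strict_linear by (auto simp: strict_linear_order_on_def total_on_def)

lemma finite_order: "finite \<xi>"
  using finite_subset[OF subset_pairs] finite_pairs[OF finite_A] by blast

lemma acyclic_order: "acyclic \<xi>"
  using strict_linear by (auto simp: strict_linear_order_on_def acyclic_irrefl)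

lemma wf_order: "wf \<xi>"
  using finite_order acyclic_order by (rule finite_acyclic_wf)

lemma next_inD: "next_in \<xi> x x' \<Longrightarrow> (x, x') \<in> \<xi>"
  by (simp add: next_in_def)

lemma next_exists:
  assumes "(x, y) \<in> \<xi>"
  obtains x' where "next_in \<xi> x x'" "(x', y) \<in> \<xi>\<^sup>="
proof -
  obtain z where z: "(x, z) \<in> \<xi>" "\<And>w. (w, z) \<in> \<xi> \<Longrightarrow> (x, w) \<notin> \<xi>"
    using wfE_min[OF wf_order, of y "{z. (x, z) \<in> \<xi>}"] assms by auto
  then have "next_in \<xi> x z"
    by (auto simp: next_in_def)
  moreover have "(z, y) \<in> \<xi>\<^sup>="
    using z assms order_total[of z y] in_A by blast
  ultimately show ?thesis ..
qed

lemma prev_exists: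
  assumes "(x, y) \<in> \<xi>"
  obtains y' where "next_in \<xi> y' y" "(x, y') \<in> \<xi>\<^sup>="
proof -
  have "wf (\<xi>\<inverse>)"
    using finite_order acyclic_order by (rule finite_acyclic_wf_converse)
  then obtain z where z: "(z, y) \<in> \<xi>" "\<And>w. (z, w) \<in> \<xi> \<Longrightarrow> (w, y) \<notin> \<xi>"
    using wfE_min[of "\<xi>\<inverse>" x "{z. (z, y) \<in> \<xi>}"] assms by auto
  then have "next_in \<xi> z y"
    by (auto simp: next_in_def)
  moreover have "(x, z) \<in> \<xi>\<^sup>="
    using z assms order_total[of z x] in_A by blast
  ultimately show ?thesis ..
qed

text \<open>Induction along the order, appending the last step. The contrapositive finds, for two
  different orders, neighbours of one that the other ranks the opposite way.\<close>

lemma order_subset_if_next_subset: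
  assumes "trans r" and next_r: "\<And>a b. next_in \<xi> a b \<Longrightarrow> (a, b) \<in> r"
  shows "\<xi> \<subseteq> r"
proof -
  have "(x, y) \<in> \<xi> \<longrightarrow> (x, y) \<in> r" for x y
  proof (induction y rule: wf_induct_rule[OF wf_order])
    case (1 y)
    show ?case
    proof
      assume "(x, y) \<in> \<xi>"
      then obtain y' where y': "next_in \<xi> y' y" "(x, y') \<in> \<xi>\<^sup>="
        by (rule prev_exists)
      show "(x, y) \<in> r"
      proof (cases "x = y'")
        case True
        then show ?thesis
          using next_r y' by simp
      next
        case False
        then have "(x, y') \<in> r"
          using 1[of y'] y' next_inD by simp
        then show ?thesis
          using \<open>trans r\<close> next_r[OF y'(1)] by (auto dest: transD)
      qed
    qed
  qed
  then show ?thesis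
    by auto
qed

text \<open>Margins are antisymmetric and the order is total, so containing every pair of positive
  margin means containing no pair of negative margin. For a fixed order this is a closed condition
  on \<open>v\<close>.\<close>

lemma admissible_iff: "admissible A v \<xi> \<longleftrightarrow> (\<forall>(x, y) \<in> \<xi>. 0 \<le> indirect_margin A v x y)"
proof -
  have anti: "indirect_margin A v y x = - indirect_margin A v x y" for x y
    by (simp add: indirect_margin_def)
  have "indirect_comparison A v \<subseteq> \<xi> \<longleftrightarrow> (\<forall>(x, y) \<in> \<xi>. 0 \<le> indirect_margin A v x y)"
  proof
    assume sub: "indirect_comparison A v \<subseteq> \<xi>"
    have "0 \<le> indirect_margin A v x y" if "(x, y) \<in> \<xi>" for x y
      using that sub in_A[OF that] order_asym[OF that] anti[of y x]
      by (force simp: indirect_comparison_def pairs_def)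
    then show "\<forall>(x, y) \<in> \<xi>. 0 \<le> indirect_margin A v x y"
      by auto
  next
    assume nonneg: "\<forall>(x, y) \<in> \<xi>. 0 \<le> indirect_margin A v x y"
    show "indirect_comparison A v \<subseteq> \<xi>"
    proof clarify
      fix x y assume "(x, y) \<in> indirect_comparison A v"
      then have xy: "x \<in> A" "y \<in> A" "x \<noteq> y" "indirect_margin A v x y > 0"
        by (auto simp: indirect_comparison_def pairs_def)
      then have "(y, x) \<notin> \<xi>"
        using nonneg anti[of y x] by fastforce
      then show "(x, y) \<in> \<xi>"
        using xy order_total by blast
    qed
  qed
  then show ?thesis
    using subset_pairs strict_linear by (simp add: admissible_def)
qed

section \<open>Margins of consecutive steps\<close>

definition outer_pairs :: "'a \<Rightarrow> 'a \<Rightarrow> 'a rel" where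
  "outer_pairs x x' = {(p, q). (p, x) \<in> \<xi>\<^sup>= \<and> (x', q) \<in> \<xi>\<^sup>=}"

lemma sigma_margin_eq:
  "sigma_margin A v \<xi> x x' = Min ((\<lambda>(p, q). indirect_margin A v p q) ` outer_pairs x x')"
proof -
  have "{indirect_margin A v p q | p q. (p, x) \<in> \<xi>\<^sup>= \<and> (x', q) \<in> \<xi>\<^sup>=}
      = (\<lambda>(p, q). indirect_margin A v p q) ` outer_pairs x x'"
    by (auto simp: image_iff outer_pairs_def)
  then show ?thesis
    by (simp add: sigma_margin_def)
qed

lemma self_in_outer_pairs: "(x, x') \<in> outer_pairs x x'"
  by (simp add: outer_pairs_def)

lemma outer_pairs_subset: "(x, x') \<in> \<xi> \<Longrightarrow> outer_pairs x x' \<subseteq> \<xi>"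
  by (auto simp: outer_pairs_def intro: order_trans order_trans[OF order_trans])

lemma finite_outer_pairs: "(x, x') \<in> \<xi> \<Longrightarrow> finite (outer_pairs x x')"
  using outer_pairs_subset finite_order by (rule finite_subset)

lemma sigma_margin_le:
  assumes "(x, x') \<in> \<xi>" "(p, q) \<in> outer_pairs x x'"
  shows "sigma_margin A v \<xi> x x' \<le> indirect_margin A v p q"
proof -
  have "Min ((\<lambda>(p, q). indirect_margin A v p q) ` outer_pairs x x')
      \<le> (\<lambda>(p, q). indirect_margin A v p q) (p, q)"
    using finite_outer_pairs[OF assms(1)] assms(2) by (intro Min_le finite_imageI imageI)
  then show ?thesis
    by (simp add: sigma_margin_eq)
qed

lemma sigma_margin_nonneg:
  assumes "admissible A v \<xi>" "(x, x') \<in> \<xi>"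
  shows "0 \<le> sigma_margin A v \<xi> x x'"
  unfolding sigma_margin_eq
proof (rule Min.boundedI)
  show "finite ((\<lambda>(p, q). indirect_margin A v p q) ` outer_pairs x x')"
    using finite_outer_pairs[OF assms(2)] by simp
  show "(\<lambda>(p, q). indirect_margin A v p q) ` outer_pairs x x' \<noteq> {}"
    using self_in_outer_pairs by blast
  show "0 \<le> m" if m: "m \<in> (\<lambda>(p, q). indirect_margin A v p q) ` outer_pairs x x'" for m
  proof -
    obtain p q where "(p, q) \<in> outer_pairs x x'" "m = indirect_margin A v p q"
      using m by auto
    then show ?thesis
      using assms(1) outer_pairs_subset[OF assms(2)] by (auto simp: admissible_iff)
  qed
qed

lemma sigma_margin_le_1:
  assumes "v \<in> llull A" "(x, x') \<in> \<xi>"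
  shows "sigma_margin A v \<xi> x x' \<le> 1"
proof -
  have "sigma_margin A v \<xi> x x' \<le> indirect_margin A v x x'"
    using assms(2) self_in_outer_pairs by (rule sigma_margin_le)
  also have "\<dots> \<le> 1"
    using subset_pairs assms(2) by (intro indirect_margin_le_1[OF finite_A _ assms(1)]) (rule subsetD)
  finally show ?thesis .
qed

lemma sigma_margin_tendsto:
  assumes "(x, x') \<in> \<xi>" and V: "\<And>p. p \<in> pairs A \<Longrightarrow> ((\<lambda>w. V w p) \<longlongrightarrow> v p) F"
  shows "((\<lambda>w. sigma_margin A (V w) \<xi> x x') \<longlongrightarrow> sigma_margin A v \<xi> x x') F"
  unfolding sigma_margin_eq
proof (rule tendsto_Min_image)
  show "finite (outer_pairs x x')"
    using assms(1) by (rule finite_outer_pairs)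
  show "outer_pairs x x' \<noteq> {}"
    using self_in_outer_pairs by blast
  fix e assume "e \<in> outer_pairs x x'"
  then have "e \<in> pairs A"
    using outer_pairs_subset[OF assms(1)] subset_pairs by blast
  then have "((\<lambda>w. indirect_margin A (V w) (fst e) (snd e)) \<longlongrightarrow> indirect_margin A v (fst e) (snd e)) F"
    by (intro indirect_margin_tendsto finite_A V) simp_all
  then show "((\<lambda>w. case e of (p, q) \<Rightarrow> indirect_margin A (V w) p q) \<longlongrightarrow>
      (case e of (p, q) \<Rightarrow> indirect_margin A v p q)) F"
    by (simp add: case_prod_beta)
qed

end

section \<open>Continuity for a fixed order\<close>

context finite_order
begin

lemma feasible_turnoutsD:
  assumes "\<tau> \<in> feasible_turnouts A v \<xi>"
  shows feasible_ext: "\<tau> \<in> pairs A \<rightarrow>\<^sub>E UNIV"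
    and feasible_sym: "(x, y) \<in> pairs A \<Longrightarrow> \<tau> (x, y) = \<tau> (y, x)"
    and feasible_ge: "next_in \<xi> x x' \<Longrightarrow> sigma_margin A v \<xi> x x' \<le> \<tau> (x, x')"
    and feasible_le_1: "next_in \<xi> x x' \<Longrightarrow> \<tau> (x, x') \<le> 1"
    and feasible_diff_nonneg: "next_in \<xi> x x' \<Longrightarrow> z \<in> A - {x, x'} \<Longrightarrow> 0 \<le> \<tau> (x, z) - \<tau> (x', z)"
    and feasible_diff_le: "next_in \<xi> x x' \<Longrightarrow> z \<in> A - {x, x'} \<Longrightarrow>
      \<tau> (x, z) - \<tau> (x', z) \<le> sigma_margin A v \<xi> x x'"
proof -
  note D = assms[unfolded feasible_turnouts_def mem_Collect_eq]
  show "\<tau> \<in> pairs A \<rightarrow>\<^sub>E UNIV"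
    using D by (rule conjunct1)
  show "\<tau> (x, y) = \<tau> (y, x)" if "(x, y) \<in> pairs A"
    using conjunct1[OF conjunct2[OF D]] that by auto
  note D' = conjunct2[OF conjunct2[OF D], rule_format]
  show "sigma_margin A v \<xi> x x' \<le> \<tau> (x, x')" "\<tau> (x, x') \<le> 1" if "next_in \<xi> x x'"
    using D'[OF that] by auto
  show "0 \<le> \<tau> (x, z) - \<tau> (x', z)" "\<tau> (x, z) - \<tau> (x', z) \<le> sigma_margin A v \<xi> x x'"
    if "next_in \<xi> x x'" "z \<in> A - {x, x'}"
    using D'[OF that(1)] that(2) by auto
qed

lemma feasible_turnoutsI:
  assumes "\<tau> \<in> pairs A \<rightarrow>\<^sub>E UNIV"
    and "\<And>x y. (x, y) \<in> pairs A \<Longrightarrow> \<tau> (x, y) = \<tau> (y, x)"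
    and "\<And>x x'. next_in \<xi> x x' \<Longrightarrow> sigma_margin A v \<xi> x x' \<le> \<tau> (x, x')"
    and "\<And>x x'. next_in \<xi> x x' \<Longrightarrow> \<tau> (x, x') \<le> 1"
    and "\<And>x x' z. next_in \<xi> x x' \<Longrightarrow> z \<in> A - {x, x'} \<Longrightarrow> 0 \<le> \<tau> (x, z) - \<tau> (x', z)"
    and "\<And>x x' z. next_in \<xi> x x' \<Longrightarrow> z \<in> A - {x, x'} \<Longrightarrow>
      \<tau> (x, z) - \<tau> (x', z) \<le> sigma_margin A v \<xi> x x'"
  shows "\<tau> \<in> feasible_turnouts A v \<xi>"
  unfolding feasible_turnouts_def mem_Collect_eq
proof (intro conjI allI impI ballI)
  show "case e of (x, y) \<Rightarrow> \<tau> (x, y) = \<tau> (y, x)" if "e \<in> pairs A" for e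
    using that assms(2) by (cases e) simp
qed (fact assms)+

lemma next_in_pairs:
  assumes "next_in \<xi> x x'"
  shows "(x, x') \<in> pairs A" "z \<in> A - {x, x'} \<Longrightarrow> (x, z) \<in> pairs A" "z \<in> A - {x, x'} \<Longrightarrow> (x', z) \<in> pairs A"
  using in_A[OF next_inD[OF assms]] by (auto simp: pairs_def)

lemma pairs_sym: "(x, y) \<in> pairs A \<Longrightarrow> (y, x) \<in> pairs A"
  by (auto simp: pairs_def)

text \<open>All differences are 0 and all step margins lie in [0,1]. This point serves three times:
  for existence of a minimiser, for bounding minimisers, and as the centre of contraction.\<close>

lemma const_1_feasible:
  assumes "v \<in> llull A" "admissible A v \<xi>"
  shows "(\<lambda>p\<in>pairs A. 1) \<in> feasible_turnouts A v \<xi>"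
  using sigma_margin_nonneg[OF assms(2) next_inD] sigma_margin_le_1[OF assms(1) next_inD]
  by (intro feasible_turnoutsI) (simp_all add: next_in_pairs pairs_sym)

lemma midpoint_feasible:
  assumes "r \<in> feasible_turnouts A v \<xi>" "s \<in> feasible_turnouts A v \<xi>"
  shows "(\<lambda>p\<in>pairs A. (r p + s p) / 2) \<in> feasible_turnouts A v \<xi>"
proof (rule feasible_turnoutsI)
  note r = feasible_turnoutsD[OF assms(1)] and s = feasible_turnoutsD[OF assms(2)]
  show "(\<lambda>p\<in>pairs A. (r p + s p) / 2) \<in> pairs A \<rightarrow>\<^sub>E UNIV"
    by simp
  show "(\<lambda>p\<in>pairs A. (r p + s p) / 2) (x, y) = (\<lambda>p\<in>pairs A. (r p + s p) / 2) (y, x)"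
    if "(x, y) \<in> pairs A" for x y
    using r(2)[OF that] s(2)[OF that] that pairs_sym[OF that] by simp
  fix x x' assume n: "next_in \<xi> x x'"
  show "sigma_margin A v \<xi> x x' \<le> (\<lambda>p\<in>pairs A. (r p + s p) / 2) (x, x')"
    using r(3)[OF n] s(3)[OF n] next_in_pairs[OF n] by simp
  show "(\<lambda>p\<in>pairs A. (r p + s p) / 2) (x, x') \<le> 1"
    using r(4)[OF n] s(4)[OF n] next_in_pairs[OF n] by simp
  fix z assume z: "z \<in> A - {x, x'}"
  note p = next_in_pairs(2,3)[OF n z]
  show "0 \<le> (\<lambda>p\<in>pairs A. (r p + s p) / 2) (x, z) - (\<lambda>p\<in>pairs A. (r p + s p) / 2) (x', z)"
    using r(5)[OF n z] s(5)[OF n z] p by (simp add: field_simps)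
  show "(\<lambda>p\<in>pairs A. (r p + s p) / 2) (x, z) - (\<lambda>p\<in>pairs A. (r p + s p) / 2) (x', z)
      \<le> sigma_margin A v \<xi> x x'"
    using r(6)[OF n z] s(6)[OF n z] p by (simp add: field_simps)
qed

text \<open>
  The constraints are star-shaped about the constant 1: contracting towards it adapts a feasible
  point to nearby margins, even where some of them vanish.
\<close>

lemma contract_feasible:
  assumes \<tau>: "\<tau> \<in> feasible_turnouts A v \<xi>" and \<mu>: "0 \<le> \<mu>"
    and "\<And>x x'. next_in \<xi> x x' \<Longrightarrow> \<mu> * sigma_margin A v \<xi> x x' \<le> sigma_margin A w \<xi> x x'"
    and "\<And>x x'. next_in \<xi> x x' \<Longrightarrow> \<mu> * (1 - sigma_margin A v \<xi> x x') \<le> 1 - sigma_margin A w \<xi> x x'"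
  shows "(\<lambda>p\<in>pairs A. 1 - \<mu> * (1 - \<tau> p)) \<in> feasible_turnouts A w \<xi>" (is "?r \<in> _")
proof (rule feasible_turnoutsI)
  note t = feasible_turnoutsD[OF \<tau>]
  show "?r \<in> pairs A \<rightarrow>\<^sub>E UNIV"
    by simp
  show "?r (x, y) = ?r (y, x)" if "(x, y) \<in> pairs A" for x y
    using t(2)[OF that] that pairs_sym[OF that] by simp
  fix x x' assume n: "next_in \<xi> x x'"
  \<comment> \<open>Contraction multiplies the distance to 1 by \<open>\<mu>\<close>, so the lower
    bound for \<open>w\<close> comes down to \<open>assms(4)\<close>; differences are also
    multiplied by \<open>\<mu>\<close>, which leads to \<open>assms(3)\<close>.\<close>
  have "\<mu> * (1 - \<tau> (x, x')) \<le> \<mu> * (1 - sigma_margin A v \<xi> x x')"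
    using t(3)[OF n] \<mu> by (intro mult_left_mono) auto
  then show "sigma_margin A w \<xi> x x' \<le> ?r (x, x')"
    using assms(4)[OF n] next_in_pairs(1)[OF n] by simp
  show "?r (x, x') \<le> 1"
    using t(4)[OF n] \<mu> next_in_pairs(1)[OF n] by simp
  fix z assume z: "z \<in> A - {x, x'}"
  have eq: "?r (x, z) - ?r (x', z) = \<mu> * (\<tau> (x, z) - \<tau> (x', z))"
    using next_in_pairs(2,3)[OF n z] by (simp add: algebra_simps)
  show "0 \<le> ?r (x, z) - ?r (x', z)"
    unfolding eq using t(5)[OF n z] \<mu> by simp
  have "\<mu> * (\<tau> (x, z) - \<tau> (x', z)) \<le> \<mu> * sigma_margin A v \<xi> x x'"
    using t(6)[OF n z] \<mu> by (rule mult_left_mono)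
  then show "?r (x, z) - ?r (x', z) \<le> sigma_margin A w \<xi> x x'"
    unfolding eq using assms(3)[OF n] by simp
qed

text \<open>All constraints are equations or weak inequalities between convergent expressions.
  Constant \<open>V\<close> gives closedness of one feasible set; moving \<open>V\<close> handles
  limits of minimisers.\<close>

lemma feasible_limit:
  assumes "F \<noteq> bot" and V: "\<And>p. p \<in> pairs A \<Longrightarrow> ((\<lambda>w. V w p) \<longlongrightarrow> v p) F"
    and f: "eventually (\<lambda>w. f w \<in> feasible_turnouts A (V w) \<xi>) F" and c: "(f \<longlongrightarrow> c) F"
  shows "c \<in> feasible_turnouts A v \<xi>"
proof (rule feasible_turnoutsI)
  note lim = tendsto_fun_apply[OF c]
  have le: "a \<le> b" if "(g \<longlongrightarrow> a) F" "(h \<longlongrightarrow> b) F"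
    "\<And>w. f w \<in> feasible_turnouts A (V w) \<xi> \<Longrightarrow> g w \<le> h w" for g h and a b :: real
    using \<open>F \<noteq> bot\<close> that(2,1) by (rule tendsto_le) (rule eventually_mono[OF f that(3)])
  have eq: "a = b" if "(g \<longlongrightarrow> a) F" "(h \<longlongrightarrow> b) F"
    "\<And>w. f w \<in> feasible_turnouts A (V w) \<xi> \<Longrightarrow> g w = h w" for g h and a b :: real
    using le[OF that(1,2)] le[OF that(2,1)] that(3) by (simp add: antisym)
  \<comment> \<open>Feasible points have the constant value \<open>undefined\<close> off
    \<open>pairs A\<close>, so the limit is extensional again.\<close>
  have "c p = undefined" if "p \<notin> pairs A" for p
    using lim[of p] tendsto_const
    by (rule eq) (rule PiE_arb[OF feasible_ext that])
  then show "c \<in> pairs A \<rightarrow>\<^sub>E UNIV"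
    by (auto simp: PiE_iff extensional_def)
  show "c (x, y) = c (y, x)" if "(x, y) \<in> pairs A" for x y
    using lim lim by (rule eq) (rule feasible_sym[OF _ that])
  fix x x' assume n: "next_in \<xi> x x'"
  have sigma: "((\<lambda>w. sigma_margin A (V w) \<xi> x x') \<longlongrightarrow> sigma_margin A v \<xi> x x') F"
    by (rule sigma_margin_tendsto[OF next_inD[OF n]]) (rule V)
  show "sigma_margin A v \<xi> x x' \<le> c (x, x')"
    using sigma lim by (rule le) (rule feasible_ge[OF _ n])
  show "c (x, x') \<le> 1"
    using lim tendsto_const by (rule le) (rule feasible_le_1[OF _ n])
  fix z assume z: "z \<in> A - {x, x'}"
  show "0 \<le> c (x, z) - c (x', z)"
    using tendsto_const tendsto_diff[OF lim lim] by (rule le) (rule feasible_diff_nonneg[OF _ n z])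
  show "c (x, z) - c (x', z) \<le> sigma_margin A v \<xi> x x'"
    using tendsto_diff[OF lim lim] sigma by (rule le) (rule feasible_diff_le[OF _ n z])
qed

section \<open>The minimising turnouts and their continuity\<close>

lemma objective_eq:
  "(\<Sum>x\<in>A. \<Sum>y\<in>A - {x}. (\<tau> (x, y) - turnout v x y)\<^sup>2)
    = (\<Sum>p\<in>pairs A. (\<tau> p - turnout v (fst p) (snd p))\<^sup>2)"
proof -
  have "pairs A = Sigma A (\<lambda>x. A - {x})"
    by (auto simp: pairs_def)
  then show ?thesis
    using finite_A by (simp add: sum.Sigma case_prod_beta)
qed

abbreviation "fits_best v \<equiv>
  is_arg_min (\<lambda>\<tau>. \<Sum>p\<in>pairs A. (\<tau> p - turnout v (fst p) (snd p))\<^sup>2)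
    (\<lambda>\<tau>. \<tau> \<in> feasible_turnouts A v \<xi>)"

lemma ex1_fits_best:
  assumes "v \<in> llull A" "admissible A v \<xi>"
  shows "\<exists>!\<tau>. fits_best v \<tau>"
proof (rule ex1_least_squares)
  show "finite (pairs A)"
    by (rule finite_pairs[OF finite_A])
  show "feasible_turnouts A v \<xi> \<subseteq> pairs A \<rightarrow>\<^sub>E UNIV"
    using feasible_ext by (rule subsetI)
  show "(\<lambda>p\<in>pairs A. 1) \<in> feasible_turnouts A v \<xi>"
    using assms by (rule const_1_feasible)
  show "closed (feasible_turnouts A v \<xi>)"
  proof (rule closed_if_contains_filter_limits)
    show "c \<in> feasible_turnouts A v \<xi>"
      if "F \<noteq> bot" "eventually (\<lambda>\<tau>. \<tau> \<in> feasible_turnouts A v \<xi>) F" "((\<lambda>\<tau>. \<tau>) \<longlongrightarrow> c) F" for F c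
      using that(1) tendsto_const that(2,3) by (rule feasible_limit)
  qed
qed (rule midpoint_feasible)

lemma fits_best_sigma_turnout:
  assumes "v \<in> llull A" "admissible A v \<xi>"
  shows "fits_best v (sigma_turnout A v \<xi>)"
  using theI'[OF ex1_fits_best[OF assms]] by (simp only: sigma_turnout_def objective_eq)

lemma fits_best_unique:
  assumes "v \<in> llull A" "admissible A v \<xi>" and c: "fits_best v c"
  shows "c = sigma_turnout A v \<xi>"
proof -
  have "(THE \<tau>. fits_best v \<tau>) = c"
  proof (rule the1_equality)
    show "\<exists>!\<tau>. fits_best v \<tau>"
      using assms(1,2) by (rule ex1_fits_best)
    show "fits_best v c"
      by (rule c)
  qed
  then show ?thesis
    by (simp only: sigma_turnout_def objective_eq)
qed

lemma sigma_turnout_feasible: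
  assumes "v \<in> llull A" "admissible A v \<xi>"
  shows "sigma_turnout A v \<xi> \<in> feasible_turnouts A v \<xi>"
  using fits_best_sigma_turnout[OF assms] by (simp add: is_arg_min_def)

lemma turnout_bounds:
  assumes "v \<in> llull A" "p \<in> pairs A"
  shows "0 \<le> turnout v (fst p) (snd p)" "turnout v (fst p) (snd p) \<le> 1"
proof -
  have "0 \<le> v (x, y)" "v (x, y) + v (y, x) \<le> 1" if "(x, y) \<in> pairs A" for x y
    using that assms(1) by (auto simp: llull_def PiE_iff)
  then show "0 \<le> turnout v (fst p) (snd p)" "turnout v (fst p) (snd p) \<le> 1"
    using assms(2) pairs_sym by (cases p; simp add: turnout_def)+
qed

text \<open>The minimiser does no worse than the constant 1, whose objective is at most the number
  \<open>n\<close> of pairs since turnouts lie in [0,1]. Using \<open>n \<le> n * n\<close> avoids a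
  root: every coordinate is within \<open>n\<close> of a turnout, hence within \<open>n + 1\<close>
  of 0.\<close>

lemma sigma_turnout_bounded:
  assumes "v \<in> llull A" "admissible A v \<xi>"
  defines "B \<equiv> 1 + real (card (pairs A))"
  shows "sigma_turnout A v \<xi> \<in> pairs A \<rightarrow>\<^sub>E {-B..B}"
proof (rule PiE_I)
  let ?t = "\<lambda>p. turnout v (fst p) (snd p)"
  note t = turnout_bounds[OF assms(1)]
  show "sigma_turnout A v \<xi> p = undefined" if "p \<notin> pairs A" for p
    by (rule PiE_arb[OF feasible_ext[OF sigma_turnout_feasible[OF assms(1,2)]] that])
  fix p assume p: "p \<in> pairs A"
  have "(\<Sum>q\<in>pairs A. (sigma_turnout A v \<xi> q - ?t q)\<^sup>2) \<le> (\<Sum>q\<in>pairs A. ((\<lambda>p\<in>pairs A. 1) q - ?t q)\<^sup>2)"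
    using fits_best_sigma_turnout[OF assms(1,2)] const_1_feasible[OF assms(1,2)]
    by (simp only: is_arg_min_linorder)
  also have "\<dots> \<le> (\<Sum>q\<in>pairs A. 1)"
    using t by (intro sum_mono) (auto simp: power2_eq_square intro!: mult_le_one)
  also have "\<dots> \<le> (real (card (pairs A)))\<^sup>2"
    by (simp add: power2_eq_square flip: of_nat_mult)
  finally have "\<bar>sigma_turnout A v \<xi> p - ?t p\<bar> \<le> real (card (pairs A))"
    by (intro abs_diff_le_if_sum_squares_le[OF finite_pairs[OF finite_A] p]) simp_all
  then show "sigma_turnout A v \<xi> p \<in> {-B..B}"
    using t[OF p] by (simp add: B_def abs_le_iff)
qed

text \<open>The nearby feasible points are the minimiser at \<open>v\<close> contracted towards 1 by
  a factor \<open>\<mu> w\<close> that tends to 1 and meets the conditions of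
  \<open>contract_feasible\<close>.\<close>

lemma sigma_turnout_tendsto:
  assumes V: "\<And>p. p \<in> pairs A \<Longrightarrow> ((\<lambda>w. V w p) \<longlongrightarrow> v p) F"
    and ev: "eventually (\<lambda>w. V w \<in> llull A \<and> admissible A (V w) \<xi>) F"
    and v: "v \<in> llull A" "admissible A v \<xi>"
  shows "((\<lambda>w. sigma_turnout A (V w) \<xi>) \<longlongrightarrow> sigma_turnout A v \<xi>) F"
proof -
  define M where "M = {e. next_in \<xi> (fst e) (snd e)}"
  define \<sigma> where "\<sigma> u e = sigma_margin A u \<xi> (fst e) (snd e)" for u e
  \<comment> \<open>The largest factor up to 1 that both conditions of
    \<open>contract_feasible\<close> permit at the step \<open>e\<close>. Where
    \<open>\<sigma> v e\<close> is 0 or 1, one condition holds for every factor, and the default 1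
    preserves the limit 1.\<close>
  define b where "b w e = min 1 (min (if \<sigma> v e = 0 then 1 else \<sigma> (V w) e / \<sigma> v e)
    (if \<sigma> v e = 1 then 1 else (1 - \<sigma> (V w) e) / (1 - \<sigma> v e)))" for w e
  \<comment> \<open>For the matrices in question all factors lie in [0,1], so the product is at most
    each of them; unlike a minimum it covers an order without steps.\<close>
  define \<mu> where "\<mu> w = (\<Prod>e\<in>M. b w e)" for w
  have M: "M \<subseteq> \<xi>"
    using next_inD by (auto simp: M_def)
  then have "finite M"
    using finite_order by (rule finite_subset)
  have bounds: "0 \<le> \<sigma> u e" "\<sigma> u e \<le> 1" if "u \<in> llull A \<and> admissible A u \<xi>" "e \<in> M" for u e
    using that M by (auto simp: \<sigma>_def intro!: sigma_margin_nonneg sigma_margin_le_1)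
  have b: "0 \<le> b w e" "b w e \<le> 1" "b w e * \<sigma> v e \<le> \<sigma> (V w) e"
    "b w e * (1 - \<sigma> v e) \<le> 1 - \<sigma> (V w) e"
    if w: "V w \<in> llull A \<and> admissible A (V w) \<xi>" and e: "e \<in> M" for w e
  proof -
    note vb = bounds[OF conjI[OF v] e] and wb = bounds[OF w e]
    show "0 \<le> b w e" "b w e \<le> 1"
      using vb wb by (auto simp: b_def)
    show "b w e * \<sigma> v e \<le> \<sigma> (V w) e"
    proof (cases "\<sigma> v e = 0")
      case False
      then have "b w e \<le> \<sigma> (V w) e / \<sigma> v e"
        by (simp add: b_def)
      then show ?thesis
        using False vb by (simp add: pos_le_divide_eq)
    qed (use wb in simp)
    show "b w e * (1 - \<sigma> v e) \<le> 1 - \<sigma> (V w) e"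
    proof (cases "\<sigma> v e = 1")
      case False
      then have "b w e \<le> (1 - \<sigma> (V w) e) / (1 - \<sigma> v e)"
        by (simp add: b_def)
      then show ?thesis
        using False vb by (simp add: pos_le_divide_eq)
    qed (use wb in simp)
  qed
  have \<mu>: "0 \<le> \<mu> w" "e \<in> M \<Longrightarrow> \<mu> w \<le> b w e"
    if w: "V w \<in> llull A \<and> admissible A (V w) \<xi>" for w e
  proof -
    show "0 \<le> \<mu> w"
      unfolding \<mu>_def using b(1)[OF w] by (rule prod_nonneg)
    assume e: "e \<in> M"
    have "\<mu> w = b w e * (\<Prod>e\<in>M - {e}. b w e)"
      unfolding \<mu>_def using \<open>finite M\<close> e by (rule prod.remove)
    also have "\<dots> \<le> b w e * 1"
      using b[OF w] e by (intro mult_left_mono prod_le_1) auto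
    finally show "\<mu> w \<le> b w e"
      by simp
  qed
  have "((\<lambda>w. b w e) \<longlongrightarrow> 1) F" if "e \<in> M" for e
  proof -
    have s: "((\<lambda>w. \<sigma> (V w) e) \<longlongrightarrow> \<sigma> v e) F"
      unfolding \<sigma>_def using that M by (intro sigma_margin_tendsto V) auto
    have "((\<lambda>w. if \<sigma> v e = 0 then 1 else \<sigma> (V w) e / \<sigma> v e) \<longlongrightarrow> 1) F"
      using tendsto_divide[OF s tendsto_const, of "\<sigma> v e"] by (cases "\<sigma> v e = 0") simp_all
    moreover have "((\<lambda>w. if \<sigma> v e = 1 then 1 else (1 - \<sigma> (V w) e) / (1 - \<sigma> v e)) \<longlongrightarrow> 1) F"
      using tendsto_divide[OF tendsto_diff[OF tendsto_const s, of 1] tendsto_const, of "1 - \<sigma> v e"]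
      by (cases "\<sigma> v e = 1") simp_all
    ultimately have "((\<lambda>w. b w e) \<longlongrightarrow> min 1 (min 1 1)) F"
      unfolding b_def by (intro tendsto_min tendsto_const)
    then show ?thesis
      by simp
  qed
  then have "(\<mu> \<longlongrightarrow> (\<Prod>e\<in>M. 1)) F"
    unfolding \<mu>_def by (rule tendsto_prod)
  then have \<mu>_lim: "(\<mu> \<longlongrightarrow> 1) F"
    by simp
  let ?g = "\<lambda>w. \<lambda>p\<in>pairs A. 1 - \<mu> w * (1 - sigma_turnout A v \<xi> p)"
  show ?thesis
  proof (rule least_squares_tendsto[where g = ?g and K = "\<lambda>w. feasible_turnouts A (V w) \<xi>"])
    show "finite (pairs A)"
      by (rule finite_pairs[OF finite_A])
    show "eventually (\<lambda>w. fits_best (V w) (sigma_turnout A (V w) \<xi>)) F"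
      using ev by (rule eventually_mono) (blast intro: fits_best_sigma_turnout)
    show "eventually (\<lambda>w. sigma_turnout A (V w) \<xi>
        \<in> pairs A \<rightarrow>\<^sub>E {-(1 + real (card (pairs A)))..1 + real (card (pairs A))}) F"
      using ev by (rule eventually_mono) (rule sigma_turnout_bounded, simp_all)
    show "fits_best v (sigma_turnout A v \<xi>)"
      using v by (rule fits_best_sigma_turnout)
    show "c = sigma_turnout A v \<xi>" if "fits_best v c" for c
      using v that by (rule fits_best_unique)
    show "((\<lambda>w. turnout (V w) (fst p) (snd p)) \<longlongrightarrow> turnout v (fst p) (snd p)) F" if "p \<in> pairs A" for p
      unfolding turnout_def using that by (cases p) (simp add: pairs_sym tendsto_add V)
    show "c \<in> feasible_turnouts A v \<xi>"
      if "F' \<le> F" "F' \<noteq> bot" "((\<lambda>w. sigma_turnout A (V w) \<xi>) \<longlongrightarrow> c) F'" for F' c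
    proof (rule feasible_limit[OF that(2) _ _ that(3)])
      show "((\<lambda>w. V w p) \<longlongrightarrow> v p) F'" if "p \<in> pairs A" for p
        using \<open>F' \<le> F\<close> V[OF that] by (rule tendsto_mono)
      show "eventually (\<lambda>w. sigma_turnout A (V w) \<xi> \<in> feasible_turnouts A (V w) \<xi>) F'"
        using filter_leD[OF that(1) ev] by (rule eventually_mono) (blast intro: sigma_turnout_feasible)
    qed
    show "eventually (\<lambda>w. ?g w \<in> feasible_turnouts A (V w) \<xi>) F"
      using ev
    proof (rule eventually_mono)
      fix w assume w: "V w \<in> llull A \<and> admissible A (V w) \<xi>"
      have "\<mu> w * \<sigma> v e \<le> \<sigma> (V w) e" "\<mu> w * (1 - \<sigma> v e) \<le> 1 - \<sigma> (V w) e" if e: "e \<in> M" for e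
        using mult_right_mono[OF \<mu>(2)[OF w e] bounds(1)[OF conjI[OF v] e]] b(3)[OF w e]
          mult_right_mono[OF \<mu>(2)[OF w e], of "1 - \<sigma> v e"] bounds(2)[OF conjI[OF v] e] b(4)[OF w e]
        by linarith+
      from this[of "(_, _)"] show "?g w \<in> feasible_turnouts A (V w) \<xi>"
        by (intro contract_feasible[OF sigma_turnout_feasible[OF v] \<mu>(1)[OF w]])
          (simp_all add: M_def \<sigma>_def)
    qed
    show "((\<lambda>w. ?g w p) \<longlongrightarrow> sigma_turnout A v \<xi> p) F" if "p \<in> pairs A" for p
      using tendsto_diff[OF tendsto_const[of 1] tendsto_mult[OF \<mu>_lim tendsto_const[of "1 - sigma_turnout A v \<xi> p"]]] that
      by simp
  qed
qed

end

section \<open>Independence of the order\<close>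

lemma Max_image_insert_absorb:
  fixes f :: "'i \<Rightarrow> 'b::linorder"
  assumes "finite I" "j \<in> I" "f i \<le> f j"
  shows "Max (f ` insert i I) = Max (f ` I)"
proof -
  have "f i \<le> Max (f ` I)"
    using assms by (intro order.trans[OF assms(3)] Max_ge) auto
  then show ?thesis
    using assms(1,2) by (subst image_insert, subst Max_insert) (auto simp: max_absorb2)
qed

lemma Min_image_insert_absorb:
  fixes f :: "'i \<Rightarrow> 'b::linorder"
  assumes "finite I" "j \<in> I" "f j \<le> f i"
  shows "Min (f ` insert i I) = Min (f ` I)"
proof -
  have "Min (f ` I) \<le> f i"
    using assms by (intro order.trans[OF _ assms(3)] Min_le) auto
  then show ?thesis
    using assms(1,2) by (subst image_insert, subst Min_insert) (auto simp: min_absorb2)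
qed

section \<open>Transposing two labels in an order\<close>

abbreviation "swap \<equiv> Transposition.transpose"

lemma swap_eq_swap_iff: "swap a b x = swap a b y \<longleftrightarrow> x = y"
  by (metis transpose_involutory)

lemma swap_eq_conv: "swap a b x = y \<longleftrightarrow> x = swap a b y"
  by (metis transpose_involutory)

lemma swap_left_iff: "((a, y) \<in> r \<longleftrightarrow> (b, y) \<in> r) \<Longrightarrow> (swap a b x, y) \<in> r \<longleftrightarrow> (x, y) \<in> r"
  by (cases "x = a"; cases "x = b") simp_all

lemma swap_right_iff: "((y, a) \<in> r \<longleftrightarrow> (y, b) \<in> r) \<Longrightarrow> (y, swap a b x) \<in> r \<longleftrightarrow> (y, x) \<in> r"
  by (cases "x = a"; cases "x = b") simp_all

lemma swap_pair_cases:
  obtains "x = a" "y \<in> {a, b}" | "x = b" "y \<in> {a, b}" | "x = a" "y \<noteq> a" "y \<noteq> b"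
    | "x = b" "y \<noteq> a" "y \<noteq> b" | "x \<noteq> a" "x \<noteq> b" "y = a" | "x \<noteq> a" "x \<noteq> b" "y = b"
    | "x \<noteq> a" "x \<noteq> b" "y \<noteq> a" "y \<noteq> b"
  by blast

text \<open>The transposition is an involution, so this preimage is also the image of the order.
  Defined as a relabelling for arbitrary \<open>a\<close> and \<open>b\<close>, it transports steps
  and intervals directly.\<close>

definition swap_order :: "'a \<Rightarrow> 'a \<Rightarrow> 'a rel \<Rightarrow> 'a rel" where
  "swap_order a b \<xi> = {(x, y). (swap a b x, swap a b y) \<in> \<xi>}"

lemma in_swap_order: "(x, y) \<in> swap_order a b \<xi> \<longleftrightarrow> (swap a b x, swap a b y) \<in> \<xi>"
  by (simp add: swap_order_def)

lemma in_swap_order_refl: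
  "(x, y) \<in> (swap_order a b \<xi>)\<^sup>= \<longleftrightarrow> (swap a b x, swap a b y) \<in> \<xi>\<^sup>="
  by (auto simp: swap_order_def swap_eq_swap_iff)

lemma swap_order_swap_order: "swap_order b a (swap_order a b \<xi>) = \<xi>"
  by (auto simp: swap_order_def transpose_commute[of b a])

lemma next_in_swap_order:
  "next_in (swap_order a b \<xi>) x y \<longleftrightarrow> next_in \<xi> (swap a b x) (swap a b y)"
proof -
  have "(\<exists>z. (x', swap a b z) \<in> \<xi> \<and> (swap a b z, y') \<in> \<xi>) \<longleftrightarrow> (\<exists>z. (x', z) \<in> \<xi> \<and> (z, y') \<in> \<xi>)"
    for x' y'
    by (metis transpose_involutory)
  then show ?thesis
    by (simp add: next_in_def in_swap_order)
qed

context finite_order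
begin

definition steps_between :: "'a \<Rightarrow> 'a \<Rightarrow> ('a \<times> 'a) set" where
  "steps_between x y = {(p, p'). next_in \<xi> p p' \<and> (x, p) \<in> \<xi>\<^sup>= \<and> (p, y) \<in> \<xi>}"

lemma projected_score_wrt_eq:
  "projected_score_wrt A v \<xi> x y =
    (if (x, y) \<in> \<xi> then Max ((\<lambda>(p, p'). upper_score A v \<xi> p p') ` steps_between x y)
     else Min ((\<lambda>(p, p'). lower_score A v \<xi> p p') ` steps_between y x))"
proof -
  have "{f p p' | p p'. next_in \<xi> p p' \<and> (x, p) \<in> \<xi>\<^sup>= \<and> (p, y) \<in> \<xi>}
    = (\<lambda>(p, p'). f p p') ` steps_between x y" for f :: "'a \<Rightarrow> 'a \<Rightarrow> real" and x y
    by (auto simp: image_iff steps_between_def)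
  then show ?thesis
    by (simp add: projected_score_wrt_def)
qed

lemma finite_steps_between: "finite (steps_between x y)"
  by (rule finite_subset[OF _ finite_order]) (auto simp: steps_between_def next_inD)

lemma steps_between_nonempty:
  assumes "(x, y) \<in> \<xi>"
  shows "steps_between x y \<noteq> {}"
proof -
  obtain x' where "next_in \<xi> x x'"
    by (rule next_exists[OF assms])
  then have "(x, x') \<in> steps_between x y"
    using assms by (simp add: steps_between_def)
  then show ?thesis
    by blast
qed

lemma next_in_unique:
  assumes "next_in \<xi> a b"
  shows "next_in \<xi> a c \<longleftrightarrow> c = b" "next_in \<xi> c b \<longleftrightarrow> c = a"
proof -
  show "next_in \<xi> a c \<longleftrightarrow> c = b"
    using assms order_total[of b c] in_A[of a c] in_A[of a b] by (auto simp: next_in_def)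
  show "next_in \<xi> c b \<longleftrightarrow> c = a"
    using assms order_total[of a c] in_A[of c b] in_A[of a b] by (auto simp: next_in_def)
qed

lemma next_in_above_iff:
  assumes "next_in \<xi> a b" "c \<noteq> a" "c \<noteq> b"
  shows "(c, b) \<in> \<xi> \<longleftrightarrow> (c, a) \<in> \<xi>"
  using assms order_total[of a c] in_A[of c b] in_A[of a b] order_trans[of c a b]
  by (auto simp: next_in_def)

lemma next_in_below_iff:
  assumes "next_in \<xi> a b" "c \<noteq> a" "c \<noteq> b"
  shows "(a, c) \<in> \<xi> \<longleftrightarrow> (b, c) \<in> \<xi>"
  using assms order_total[of b c] in_A[of a c] in_A[of a b] order_trans[of a b c]
  by (auto simp: next_in_def)

lemma transpose_in_A: "next_in \<xi> a b \<Longrightarrow> swap a b x \<in> A \<longleftrightarrow> x \<in> A"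
  using in_A[OF next_inD, of a b] by (simp add: Transposition.transpose_def)

lemma transpose_in_pairs:
  "next_in \<xi> a b \<Longrightarrow> (swap a b x, swap a b y) \<in> pairs A \<longleftrightarrow> (x, y) \<in> pairs A"
  by (simp add: pairs_def transpose_in_A swap_eq_swap_iff)

lemma finite_order_swap_order:
  assumes n: "next_in \<xi> a b"
  shows "finite_order A (swap_order a b \<xi>)"
proof
  show "finite A"
    by (rule finite_A)
  show "swap_order a b \<xi> \<subseteq> pairs A"
    using subset_pairs transpose_in_pairs[OF n] by (auto simp: in_swap_order)
  have "trans (swap_order a b \<xi>)"
    by (rule transI) (auto simp: in_swap_order intro: order_trans)
  moreover have "irrefl (swap_order a b \<xi>)"
    by (rule irreflI) (auto simp: in_swap_order dest: in_A)
  moreover have "total_on A (swap_order a b \<xi>)"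
    using order_total transpose_in_A[OF n] by (auto simp: total_on_def in_swap_order swap_eq_swap_iff)
  ultimately show "strict_linear_order_on A (swap_order a b \<xi>)"
    by (simp add: strict_linear_order_on_def)
qed

text \<open>Nothing lies between \<open>a\<close> and \<open>b\<close>, so any third option compares
  alike with both, and the relabelling reverses just one pair.\<close>

lemma swap_order_eq:
  assumes n: "next_in \<xi> a b"
  shows "swap_order a b \<xi> = insert (b, a) (\<xi> - {(a, b)})"
proof -
  have irrefl: "(c, c) \<notin> \<xi>" for c
    using in_A[of c c] by blast
  note ab = next_inD[OF n] order_asym[OF next_inD[OF n]] conjunct2[OF conjunct2[OF in_A[OF next_inD[OF n]]]]
  have "(x, y) \<in> swap_order a b \<xi> \<longleftrightarrow> (x, y) \<in> insert (b, a) (\<xi> - {(a, b)})" for x y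
  proof -
    show ?thesis
    proof (cases rule: swap_pair_cases[of x a y b])
      case 1
      then show ?thesis
        using ab irrefl by (auto simp: in_swap_order)
    next
      case 2
      then show ?thesis
        using ab irrefl by (auto simp: in_swap_order)
    next
      case 3
      then show ?thesis
        using next_in_below_iff[OF n, of y] by (simp add: in_swap_order)
    next
      case 4
      then show ?thesis
        using next_in_below_iff[OF n, of y] by (simp add: in_swap_order)
    next
      case 5
      then show ?thesis
        using next_in_above_iff[OF n, of x] by (simp add: in_swap_order)
    next
      case 6
      then show ?thesis
        using next_in_above_iff[OF n, of x] by (simp add: in_swap_order)
    next
      case 7
      then show ?thesis
        by (simp add: in_swap_order)
    qed
  qed
  then show ?thesis
    by auto
qed

lemma admissible_swap_order:
  assumes n: "next_in \<xi> a b" and adm: "admissible A v \<xi>" and zero: "indirect_margin A v a b = 0"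
  shows "admissible A v (swap_order a b \<xi>)"
proof -
  have "indirect_margin A v b a = 0"
    using zero by (simp add: indirect_margin_def)
  then show ?thesis
    using adm unfolding admissible_iff finite_order.admissible_iff[OF finite_order_swap_order[OF n]]
    by (auto simp: swap_order_eq[OF n])
qed

lemma sigma_margin_zero:
  assumes "(a, b) \<in> \<xi>" "admissible A v \<xi>" "indirect_margin A v a b = 0"
  shows "sigma_margin A v \<xi> a b = 0"
  using sigma_margin_le[OF assms(1) self_in_outer_pairs, of v] sigma_margin_nonneg[OF assms(2,1)] assms(3)
  by linarith

text \<open>The margins under the minimum are not relabelled, only the set they range over is; so
  this set must be invariant under the transposition. That fails only for the step from
  \<open>a\<close> to \<open>b\<close>, where both sides are 0.\<close>

lemma sigma_margin_swap_order:
  assumes n: "next_in \<xi> a b" and adm: "admissible A v \<xi>" and zero: "indirect_margin A v a b = 0"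
    and xx': "next_in \<xi> (swap a b x) (swap a b x')"
  shows "sigma_margin A v (swap_order a b \<xi>) x x' = sigma_margin A v \<xi> (swap a b x) (swap a b x')"
proof (cases "swap a b x = a")
  case True
  then have "swap a b x' = b"
    using xx' next_in_unique(1)[OF n, of "swap a b x'"] by (simp only: True)
  with True have eqs: "x = b" "x' = a"
    by (simp_all add: swap_eq_conv)
  have "indirect_margin A v b a = 0"
    using zero by (simp add: indirect_margin_def)
  then have "sigma_margin A v (swap_order a b \<xi>) b a = 0"
    using admissible_swap_order[OF n adm zero]
    by (intro finite_order.sigma_margin_zero[OF finite_order_swap_order[OF n]])
      (simp_all add: in_swap_order next_inD n)
  then show ?thesis
    using sigma_margin_zero[OF next_inD[OF n] adm zero] by (simp add: eqs)
next
  case False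
  \<comment> \<open>As the step from \<open>y\<close> to \<open>y'\<close> is not the one from
    \<open>a\<close> to \<open>b\<close>, the options weakly above \<open>y\<close> include both or
    neither of \<open>a\<close> and \<open>b\<close>; likewise those weakly below
    \<open>y'\<close>.\<close>
  define y y' where "y = swap a b x" and "y' = swap a b x'"
  have "y \<noteq> a" "y' \<noteq> b"
    using False next_in_unique(2)[OF n, of y] xx' by (auto simp: y_def y'_def)
  have "(a, y) \<in> \<xi>\<^sup>= \<longleftrightarrow> (b, y) \<in> \<xi>\<^sup>="
    using next_inD[OF n] next_in_below_iff[OF n, of y] \<open>y \<noteq> a\<close> by (cases "y = b") simp_all
  note up = swap_left_iff[OF this]
  have "(y', a) \<in> \<xi>\<^sup>= \<longleftrightarrow> (y', b) \<in> \<xi>\<^sup>="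
    using next_inD[OF n] next_in_above_iff[OF n, of y'] \<open>y' \<noteq> b\<close> by (cases "y' = a") simp_all
  note down = swap_right_iff[OF this]
  show ?thesis
    unfolding sigma_margin_def in_swap_order_refl y_def[symmetric] y'_def[symmetric] up down ..
qed

text \<open>Margin 0 makes the two bounds on the difference of the rows of \<open>a\<close> and
  \<open>b\<close> coincide; symmetry carries the equality to the columns and settles the pair of
  \<open>a\<close> and \<open>b\<close>.\<close>

lemma feasible_transpose:
  assumes n: "next_in \<xi> a b" and zero: "sigma_margin A v \<xi> a b = 0"
    and \<tau>: "\<tau> \<in> feasible_turnouts A v \<xi>" and xy: "(x, y) \<in> pairs A"
  shows "\<tau> (swap a b x, swap a b y) = \<tau> (x, y)"
proof -
  have ab: "\<tau> (a, z) = \<tau> (b, z)" if "z \<in> A - {a, b}" for z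
    using feasible_diff_nonneg[OF \<tau> n that] feasible_diff_le[OF \<tau> n that] zero by simp
  have ab': "\<tau> (z, a) = \<tau> (z, b)" if z: "z \<in> A - {a, b}" for z
    using ab[OF z] feasible_sym[OF \<tau> next_in_pairs(2)[OF n z]] feasible_sym[OF \<tau> next_in_pairs(3)[OF n z]]
    by simp
  show ?thesis
  proof (cases rule: swap_pair_cases[of x a y b])
    case 1
    then show ?thesis
      using feasible_sym[OF \<tau> xy] xy by (auto simp: pairs_def)
  next
    case 2
    then show ?thesis
      using feasible_sym[OF \<tau> xy] xy by (auto simp: pairs_def)
  next
    case 3
    then show ?thesis
      using ab[of y] xy by (simp add: pairs_def)
  next
    case 4
    then show ?thesis
      using ab[of y] xy by (simp add: pairs_def)
  next
    case 5
    then show ?thesis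
      using ab'[of x] xy by (simp add: pairs_def)
  next
    case 6
    then show ?thesis
      using ab'[of x] xy by (simp add: pairs_def)
  next
    case 7
    then show ?thesis
      by simp
  qed
qed

lemma feasible_subset_swap_order:
  assumes n: "next_in \<xi> a b" and adm: "admissible A v \<xi>" and zero: "indirect_margin A v a b = 0"
  shows "feasible_turnouts A v \<xi> \<subseteq> feasible_turnouts A v (swap_order a b \<xi>)"
proof
  fix \<tau> assume \<tau>: "\<tau> \<in> feasible_turnouts A v \<xi>"
  note inv = feasible_transpose[OF n sigma_margin_zero[OF next_inD[OF n] adm zero] \<tau>, symmetric]
  show "\<tau> \<in> feasible_turnouts A v (swap_order a b \<xi>)"
  proof (rule finite_order.feasible_turnoutsI[OF finite_order_swap_order[OF n]])
    show "\<tau> \<in> pairs A \<rightarrow>\<^sub>E UNIV"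
      by (rule feasible_ext[OF \<tau>])
    show "\<tau> (x, y) = \<tau> (y, x)" if "(x, y) \<in> pairs A" for x y
      by (rule feasible_sym[OF \<tau> that])
    fix x x' assume "next_in (swap_order a b \<xi>) x x'"
    then have xx': "next_in \<xi> (swap a b x) (swap a b x')"
      by (simp add: next_in_swap_order)
    note sigma = sigma_margin_swap_order[OF n adm zero xx']
    have p: "(x, x') \<in> pairs A"
      using next_in_pairs(1)[OF xx'] by (simp add: transpose_in_pairs[OF n])
    show "sigma_margin A v (swap_order a b \<xi>) x x' \<le> \<tau> (x, x')" "\<tau> (x, x') \<le> 1"
      unfolding sigma inv[OF p] using feasible_ge[OF \<tau> xx'] feasible_le_1[OF \<tau> xx'] by simp_all
    fix z assume z: "z \<in> A - {x, x'}"
    then have z': "swap a b z \<in> A - {swap a b x, swap a b x'}"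
      by (simp add: transpose_in_A[OF n] swap_eq_swap_iff)
    have p: "(x, z) \<in> pairs A" "(x', z) \<in> pairs A"
      using p z by (auto simp: pairs_def)
    show "0 \<le> \<tau> (x, z) - \<tau> (x', z)" "\<tau> (x, z) - \<tau> (x', z) \<le> sigma_margin A v (swap_order a b \<xi>) x x'"
      unfolding sigma inv[OF p(1)] inv[OF p(2)]
      using feasible_diff_nonneg[OF \<tau> xx' z'] feasible_diff_le[OF \<tau> xx' z'] by simp_all
  qed
qed

text \<open>The other inclusion is the same lemma for the swapped order, which is admissible, has
  \<open>b\<close> just before \<open>a\<close> with margin 0, and swaps back to the
  original.\<close>

lemma feasible_swap_order:
  assumes n: "next_in \<xi> a b" and adm: "admissible A v \<xi>" and zero: "indirect_margin A v a b = 0"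
  shows "feasible_turnouts A v (swap_order a b \<xi>) = feasible_turnouts A v \<xi>"
proof
  have "next_in (swap_order a b \<xi>) b a"
    using n by (simp add: next_in_swap_order)
  moreover have "indirect_margin A v b a = 0"
    using zero by (simp add: indirect_margin_def)
  ultimately show "feasible_turnouts A v (swap_order a b \<xi>) \<subseteq> feasible_turnouts A v \<xi>"
    using finite_order.feasible_subset_swap_order[OF finite_order_swap_order[OF n] _
        admissible_swap_order[OF n adm zero], of b a] by (simp add: swap_order_swap_order)
qed (rule feasible_subset_swap_order[OF assms])

lemma sigma_turnout_swap_order:
  assumes "next_in \<xi> a b" "admissible A v \<xi>" "indirect_margin A v a b = 0"
  shows "sigma_turnout A v (swap_order a b \<xi>) = sigma_turnout A v \<xi>"
  by (simp add: sigma_turnout_def feasible_swap_order[OF assms])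

section \<open>Projected scores under a transposition of margin 0\<close>

lemma step_scores_swap_order:
  assumes n: "next_in \<xi> a b" and v: "v \<in> llull A" and adm: "admissible A v \<xi>"
    and zero: "indirect_margin A v a b = 0" and xx': "next_in \<xi> (swap a b x) (swap a b x')"
  shows "upper_score A v (swap_order a b \<xi>) x x' = upper_score A v \<xi> (swap a b x) (swap a b x')"
    and "lower_score A v (swap_order a b \<xi>) x x' = lower_score A v \<xi> (swap a b x) (swap a b x')"
proof -
  have "(x, x') \<in> pairs A"
    using next_in_pairs(1)[OF xx'] by (simp add: transpose_in_pairs[OF n])
  then have "sigma_turnout A v \<xi> (swap a b x, swap a b x') = sigma_turnout A v \<xi> (x, x')"
    by (rule feasible_transpose[OF n sigma_margin_zero[OF next_inD[OF n] adm zero] sigma_turnout_feasible[OF v adm]])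
  then show "upper_score A v (swap_order a b \<xi>) x x' = upper_score A v \<xi> (swap a b x) (swap a b x')"
    and "lower_score A v (swap_order a b \<xi>) x x' = lower_score A v \<xi> (swap a b x) (swap a b x')"
    by (simp_all add: upper_score_def lower_score_def sigma_margin_swap_order[OF n adm zero xx']
        sigma_turnout_swap_order[OF n adm zero])
qed

text \<open>The transposition carries the steps of an interval of the swapped order onto those of
  the relabelled interval of the original, with equal step scores.\<close>

lemma projected_score_wrt_swap_order:
  assumes n: "next_in \<xi> a b" and v: "v \<in> llull A" and adm: "admissible A v \<xi>"
    and zero: "indirect_margin A v a b = 0"
  shows "projected_score_wrt A v (swap_order a b \<xi>) x y
    = projected_score_wrt A v \<xi> (swap a b x) (swap a b y)"
proof -
  interpret swapped: finite_order A "swap_order a b \<xi>"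
    by (rule finite_order_swap_order[OF n])
  let ?s = "swap a b"
  have eq: "(\<lambda>(p, p'). f p p') ` swapped.steps_between x y = (\<lambda>(p, p'). g p p') ` steps_between (?s x) (?s y)"
    if fg: "\<And>p p'. next_in \<xi> (?s p) (?s p') \<Longrightarrow> f p p' = g (?s p) (?s p')"
    for f g :: "'a \<Rightarrow> 'a \<Rightarrow> real" and x y
  proof -
    have "steps_between (?s x) (?s y) = map_prod ?s ?s ` swapped.steps_between x y"
    proof (intro equalityI subsetI)
      fix e assume "e \<in> steps_between (?s x) (?s y)"
      then have "map_prod ?s ?s e \<in> swapped.steps_between x y"
        by (cases e) (simp add: steps_between_def swapped.steps_between_def next_in_swap_order
            in_swap_order swap_eq_conv)
      moreover have "e = map_prod ?s ?s (map_prod ?s ?s e)"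
        by (cases e) simp
      ultimately show "e \<in> map_prod ?s ?s ` swapped.steps_between x y"
        by (rule rev_image_eqI)
    next
      fix e assume "e \<in> map_prod ?s ?s ` swapped.steps_between x y"
      then show "e \<in> steps_between (?s x) (?s y)"
        by (auto simp: steps_between_def swapped.steps_between_def next_in_swap_order in_swap_order swap_eq_conv)
    qed
    moreover have "(case e of (p, p') \<Rightarrow> f p p') = (case map_prod ?s ?s e of (p, p') \<Rightarrow> g p p')"
      if "e \<in> swapped.steps_between x y" for e
      using that fg by (cases e) (simp add: swapped.steps_between_def next_in_swap_order)
    ultimately show ?thesis
      by (simp add: image_image cong: image_cong)
  qed
  show ?thesis
    unfolding projected_score_wrt_eq swapped.projected_score_wrt_eq in_swap_order
    using eq[of "upper_score A v (swap_order a b \<xi>)" "upper_score A v \<xi>"]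
      eq[of "lower_score A v (swap_order a b \<xi>)" "lower_score A v \<xi>"]
      step_scores_swap_order[OF assms]
    by presburger
qed

text \<open>Seen from \<open>c\<close>, the intervals ending in \<open>a\<close> and in
  \<open>b\<close> differ by the step between these two. The neighbouring step of the shorter
  interval absorbs it, both in the maximum and in the minimum.\<close>

lemma projected_score_wrt_adjacent:
  assumes n: "next_in \<xi> a b" and v: "v \<in> llull A" and adm: "admissible A v \<xi>"
    and zero: "indirect_margin A v a b = 0" and c: "c \<in> A - {a, b}"
  shows "projected_score_wrt A v \<xi> a c = projected_score_wrt A v \<xi> b c"
    and "projected_score_wrt A v \<xi> c a = projected_score_wrt A v \<xi> c b"
proof -
  note ab = in_A[OF next_inD[OF n]]
  note \<tau> = sigma_turnout_feasible[OF v adm]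
  have sigma: "sigma_margin A v \<xi> a b = 0"
    by (rule sigma_margin_zero[OF next_inD[OF n] adm zero])
  note inv = feasible_transpose[OF n sigma \<tau>]
  let ?U = "\<lambda>(p, p'). upper_score A v \<xi> p p'" and ?L = "\<lambda>(p, p'). lower_score A v \<xi> p p'"
  have below: "Max (?U ` steps_between a c) = Max (?U ` steps_between b c)"
    "Min (?L ` steps_between a c) = Min (?L ` steps_between b c)" if bc: "(b, c) \<in> \<xi>"
  proof -
    have ac: "(a, c) \<in> \<xi>"
      using order_trans[OF next_inD[OF n] bc] .
    have insert: "steps_between a c = insert (a, b) (steps_between b c)"
    proof (intro equalityI subsetI)
      fix e assume "e \<in> steps_between a c"
      then show "e \<in> insert (a, b) (steps_between b c)"
        using next_in_unique(1)[OF n] next_in_below_iff[OF n, of "fst e"]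
        by (cases e) (auto simp: steps_between_def)
    next
      fix e assume "e \<in> insert (a, b) (steps_between b c)"
      then show "e \<in> steps_between a c"
        using n ac order_trans[OF next_inD[OF n], of "fst e"] next_inD[OF n]
        by (cases e) (auto simp: steps_between_def)
    qed
    obtain d where d: "next_in \<xi> b d"
      by (rule next_exists[OF bc])
    have bd: "(b, d) \<in> steps_between b c"
      using d bc by (simp add: steps_between_def)
    have a: "a \<in> A - {b, d}" and "d \<noteq> b"
      using ab order_asym[OF next_inD[OF n]] next_inD[OF d] in_A[OF next_inD[OF d]] by auto
    then have "swap a b d = d"
      by (intro transpose_apply_other) auto
    then have "sigma_turnout A v \<xi> (d, b) = sigma_turnout A v \<xi> (d, a)"
      using inv[OF next_in_pairs(3)[OF d a]] by simp
    \<comment> \<open>The difference constraint of the step from \<open>b\<close> to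
      \<open>d\<close>, taken at the third option \<open>a\<close>. Since \<open>(d, a)\<close> and
      \<open>(d, b)\<close> have equal turnouts, it compares two consecutive steps.\<close>
    then have "sigma_turnout A v \<xi> (a, b) - sigma_turnout A v \<xi> (d, b) \<in> {0..sigma_margin A v \<xi> b d}"
      using feasible_diff_nonneg[OF \<tau> d a] feasible_diff_le[OF \<tau> d a]
        feasible_sym[OF \<tau> next_in_pairs(1)[OF n]] by simp
    moreover have "sigma_turnout A v \<xi> (d, b) = sigma_turnout A v \<xi> (b, d)"
      using feasible_sym[OF \<tau> next_in_pairs(1)[OF d]] by simp
    ultimately have le: "?U (a, b) \<le> ?U (b, d)" "?L (b, d) \<le> ?L (a, b)"
      using sigma by (auto simp: upper_score_def lower_score_def)
    show "Max (?U ` steps_between a c) = Max (?U ` steps_between b c)"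
      "Min (?L ` steps_between a c) = Min (?L ` steps_between b c)"
      unfolding insert
      by (rule Max_image_insert_absorb[OF finite_steps_between bd le(1)],
          rule Min_image_insert_absorb[OF finite_steps_between bd le(2)])
  qed
  have above: "Max (?U ` steps_between c b) = Max (?U ` steps_between c a)"
    "Min (?L ` steps_between c b) = Min (?L ` steps_between c a)" if ca: "(c, a) \<in> \<xi>"
  proof -
    have cb: "(c, b) \<in> \<xi>"
      using order_trans[OF ca next_inD[OF n]] .
    have insert: "steps_between c b = insert (a, b) (steps_between c a)"
    proof (intro equalityI subsetI)
      fix e assume "e \<in> steps_between c b"
      then show "e \<in> insert (a, b) (steps_between c a)"
        using next_in_unique(1)[OF n] next_in_above_iff[OF n, of "fst e"] in_A[of b b]
        by (cases e) (auto simp: steps_between_def)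
    next
      fix e assume "e \<in> insert (a, b) (steps_between c a)"
      then show "e \<in> steps_between c b"
        using n ca order_trans[OF _ next_inD[OF n], of "fst e"] next_inD[OF n]
        by (cases e) (auto simp: steps_between_def)
    qed
    obtain d where d: "next_in \<xi> d a" "(c, d) \<in> \<xi>\<^sup>="
      by (rule prev_exists[OF ca])
    have da: "(d, a) \<in> steps_between c a"
      using d next_inD[OF d(1)] by (simp add: steps_between_def)
    have b: "b \<in> A - {d, a}"
      using ab order_asym[OF next_inD[OF n]] next_inD[OF d(1)] by auto
    have "swap a b d = d"
      using in_A[OF next_inD[OF d(1)]] b by (intro transpose_apply_other) auto
    then have "sigma_turnout A v \<xi> (d, a) = sigma_turnout A v \<xi> (d, b)"
      using inv[OF next_in_pairs(1)[OF d(1)]] by simp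
    \<comment> \<open>The mirror image: the constraint of the step from \<open>d\<close> to
      \<open>a\<close>, taken at the third option \<open>b\<close>.\<close>
    then have "sigma_turnout A v \<xi> (d, a) - sigma_turnout A v \<xi> (a, b) \<in> {0..sigma_margin A v \<xi> d a}"
      using feasible_diff_nonneg[OF \<tau> d(1) b] feasible_diff_le[OF \<tau> d(1) b] by simp
    then have le: "?U (a, b) \<le> ?U (d, a)" "?L (d, a) \<le> ?L (a, b)"
      using sigma by (auto simp: upper_score_def lower_score_def)
    show "Max (?U ` steps_between c b) = Max (?U ` steps_between c a)"
      "Min (?L ` steps_between c b) = Min (?L ` steps_between c a)"
      unfolding insert
      by (rule Max_image_insert_absorb[OF finite_steps_between da le(1)],
          rule Min_image_insert_absorb[OF finite_steps_between da le(2)])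
  qed
  have "(a, c) \<in> \<xi> \<longleftrightarrow> (b, c) \<in> \<xi>" "(c, a) \<in> \<xi> \<longleftrightarrow> (c, b) \<in> \<xi>"
    using next_in_above_iff[OF n, of c] next_in_below_iff[OF n, of c] c by auto
  moreover have "(b, c) \<in> \<xi> \<and> (c, b) \<notin> \<xi> \<or> (c, a) \<in> \<xi> \<and> (a, c) \<notin> \<xi>"
    using order_total[of b c] order_asym[of b c] order_asym[of c a] calculation ab c by auto
  ultimately show "projected_score_wrt A v \<xi> a c = projected_score_wrt A v \<xi> b c"
    "projected_score_wrt A v \<xi> c a = projected_score_wrt A v \<xi> c b"
    using below above unfolding projected_score_wrt_eq by auto
qed

lemma projected_score_wrt_transpose:
  assumes n: "next_in \<xi> a b" and v: "v \<in> llull A" and adm: "admissible A v \<xi>"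
    and zero: "indirect_margin A v a b = 0" and xy: "(x, y) \<in> pairs A"
  shows "projected_score_wrt A v \<xi> (swap a b x) (swap a b y) = projected_score_wrt A v \<xi> x y"
proof -
  \<comment> \<open>Between \<open>a\<close> and \<open>b\<close> themselves there is one step, and
    its upper and lower scores agree because its margin is 0.\<close>
  have "steps_between a b = {(a, b)}"
    using n next_in_unique(1)[OF n] in_A[of a a] by (auto simp: steps_between_def next_in_def)
  then have ab: "projected_score_wrt A v \<xi> a b = projected_score_wrt A v \<xi> b a"
    using order_asym[OF next_inD[OF n]] next_inD[OF n] sigma_margin_zero[OF next_inD[OF n] adm zero]
    by (simp add: projected_score_wrt_eq upper_score_def lower_score_def)
  note adj = projected_score_wrt_adjacent[OF n v adm zero]
  show ?thesis
  proof (cases rule: swap_pair_cases[of x a y b])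
    case 1
    then show ?thesis
      using ab xy by (auto simp: pairs_def)
  next
    case 2
    then show ?thesis
      using ab xy by (auto simp: pairs_def)
  next
    case 3
    then show ?thesis
      using adj(1)[of y] xy by (simp add: pairs_def)
  next
    case 4
    then show ?thesis
      using adj(1)[of y] xy by (simp add: pairs_def)
  next
    case 5
    then show ?thesis
      using adj(2)[of x] xy by (simp add: pairs_def)
  next
    case 6
    then show ?thesis
      using adj(2)[of x] xy by (simp add: pairs_def)
  next
    case 7
    then show ?thesis
      by simp
  qed
qed

end

text \<open>Bubble sort: exchanging neighbours that \<open>\<eta>\<close> ranks the other way
  removes one pair from \<open>\<xi> - \<eta>\<close> and keeps the order admissible.\<close>

lemma projected_score_wrt_unique:
  assumes "finite A" and v: "v \<in> llull A" and xy: "(x, y) \<in> pairs A"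
    and "admissible A v \<xi>" and \<eta>: "admissible A v \<eta>"
  shows "projected_score_wrt A v \<xi> x y = projected_score_wrt A v \<eta> x y"
  using \<open>admissible A v \<xi>\<close>
proof (induction "card (\<xi> - \<eta>)" arbitrary: \<xi> rule: less_induct)
  case less
  have order: "finite_order A \<zeta>" if "admissible A v \<zeta>" for \<zeta>
    using that \<open>finite A\<close> by (simp add: finite_order_def admissible_def)
  interpret \<xi>: finite_order A \<xi>
    using less.prems by (rule order)
  interpret \<eta>: finite_order A \<eta>
    using \<eta> by (rule order)
  show ?case
  proof (cases "\<xi> \<subseteq> \<eta>")
    case True
    have "\<eta> \<subseteq> \<xi>"
    proof clarify
      fix p q assume pq: "(p, q) \<in> \<eta>"
      then show "(p, q) \<in> \<xi>"
        using True \<xi>.order_total[of p q] \<eta>.in_A[OF pq] \<eta>.order_asym[OF pq] by blast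
    qed
    with True show ?thesis
      by simp
  next
    case False
    have "trans \<eta>"
      using \<eta> by (simp add: admissible_def strict_linear_order_on_def)
    then obtain a b where n: "next_in \<xi> a b" and "(a, b) \<notin> \<eta>"
      using False \<xi>.order_subset_if_next_subset by blast
    then have ba: "(b, a) \<in> \<eta>"
      using \<eta>.order_total[of a b] \<xi>.in_A[OF \<xi>.next_inD[OF n]] by blast
    \<comment> \<open>Each order contributes one of two opposite margins, and admissibility makes
      both nonnegative.\<close>
    have "0 \<le> indirect_margin A v a b" "0 \<le> indirect_margin A v b a"
      using less.prems \<eta> \<xi>.next_inD[OF n] ba by (auto simp: \<xi>.admissible_iff \<eta>.admissible_iff)
    then have zero: "indirect_margin A v a b = 0"
      by (simp add: indirect_margin_def)
    have "swap_order a b \<xi> - \<eta> \<subset> \<xi> - \<eta>"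
      using \<xi>.next_inD[OF n] \<open>(a, b) \<notin> \<eta>\<close> ba by (auto simp: \<xi>.swap_order_eq[OF n])
    then have "card (swap_order a b \<xi> - \<eta>) < card (\<xi> - \<eta>)"
      using \<xi>.finite_order by (intro psubset_card_mono) auto
    then have "projected_score_wrt A v (swap_order a b \<xi>) x y = projected_score_wrt A v \<eta> x y"
      using \<xi>.admissible_swap_order[OF n less.prems zero] by (rule less.hyps)
    then show ?thesis
      by (simp add: \<xi>.projected_score_wrt_swap_order[OF n v less.prems zero]
          \<xi>.projected_score_wrt_transpose[OF n v less.prems zero xy])
  qed
qed

section \<open>Continuity\<close>

lemma (in finite_order) projected_score_wrt_tendsto:
  assumes xy: "(x, y) \<in> pairs A" and V: "\<And>p. p \<in> pairs A \<Longrightarrow> ((\<lambda>w. V w p) \<longlongrightarrow> v p) F"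
    and ev: "eventually (\<lambda>w. V w \<in> llull A \<and> admissible A (V w) \<xi>) F"
    and v: "v \<in> llull A" "admissible A v \<xi>"
  shows "((\<lambda>w. projected_score_wrt A (V w) \<xi> x y) \<longlongrightarrow> projected_score_wrt A v \<xi> x y) F"
proof -
  have turnout: "((\<lambda>w. sigma_turnout A (V w) \<xi>) \<longlongrightarrow> sigma_turnout A v \<xi>) F"
    using V ev v by (rule sigma_turnout_tendsto)
  have step: "((\<lambda>w. upper_score A (V w) \<xi> p p') \<longlongrightarrow> upper_score A v \<xi> p p') F"
    "((\<lambda>w. lower_score A (V w) \<xi> p p') \<longlongrightarrow> lower_score A v \<xi> p p') F" if n: "next_in \<xi> p p'" for p p'
  proof -
    have "((\<lambda>w. sigma_margin A (V w) \<xi> p p') \<longlongrightarrow> sigma_margin A v \<xi> p p') F"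
      by (rule sigma_margin_tendsto[OF next_inD[OF n]]) (rule V)
    then show "((\<lambda>w. upper_score A (V w) \<xi> p p') \<longlongrightarrow> upper_score A v \<xi> p p') F"
      "((\<lambda>w. lower_score A (V w) \<xi> p p') \<longlongrightarrow> lower_score A v \<xi> p p') F"
      unfolding upper_score_def lower_score_def
      using tendsto_fun_apply[OF turnout] by (auto intro!: tendsto_divide tendsto_add tendsto_diff)
  qed
  have "x \<in> A" "y \<in> A" "x \<noteq> y"
    using xy by (auto simp: pairs_def)
  show ?thesis
  proof (cases "(x, y) \<in> \<xi>")
    case True
    have "((\<lambda>w. Max ((\<lambda>e. upper_score A (V w) \<xi> (fst e) (snd e)) ` steps_between x y)) \<longlongrightarrow>
        Max ((\<lambda>e. upper_score A v \<xi> (fst e) (snd e)) ` steps_between x y)) F"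
      by (intro tendsto_Max_image finite_steps_between steps_between_nonempty True step)
        (auto simp: steps_between_def)
    then show ?thesis
      using True by (simp add: projected_score_wrt_eq case_prod_beta')
  next
    case False
    then have yx: "(y, x) \<in> \<xi>"
      using order_total \<open>x \<in> A\<close> \<open>y \<in> A\<close> \<open>x \<noteq> y\<close> by blast
    have "((\<lambda>w. Min ((\<lambda>e. lower_score A (V w) \<xi> (fst e) (snd e)) ` steps_between y x)) \<longlongrightarrow>
        Min ((\<lambda>e. lower_score A v \<xi> (fst e) (snd e)) ` steps_between y x)) F"
      by (intro tendsto_Min_image finite_steps_between steps_between_nonempty yx step)
        (auto simp: steps_between_def)
    then show ?thesis
      using False by (simp add: projected_score_wrt_eq case_prod_beta')
  qed
qed

lemma projected_score_eq:
  assumes "finite A" "v \<in> llull A" "(x, y) \<in> pairs A" "admissible A v \<xi>"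
  shows "projected_score A v x y = projected_score_wrt A v \<xi> x y"
  unfolding projected_score_def using assms(1-3) someI[of "admissible A v", OF assms(4)] assms(4)
  by (rule projected_score_wrt_unique)

text \<open>The finite closed cover in filter form: for each order, nearby matrices admitting it
  have scores in \<open>S\<close>. Finitely many orders can be treated at once, and every matrix
  admits one of them.\<close>

lemma projected_score_tendsto:
  assumes A: "finite A" and xy: "(x, y) \<in> pairs A"
    and V: "\<And>p. p \<in> pairs A \<Longrightarrow> ((\<lambda>w. V w p) \<longlongrightarrow> v p) F"
    and ev: "eventually (\<lambda>w. V w \<in> llull A) F" and v: "v \<in> llull A"
  shows "((\<lambda>w. projected_score A (V w) x y) \<longlongrightarrow> projected_score A v x y) F"
proof (rule topological_tendstoI)
  fix S :: "real set" assume S: "open S" "projected_score A v x y \<in> S"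
  have "eventually (\<lambda>w. V w \<in> llull A \<and> admissible A (V w) \<xi> \<longrightarrow> projected_score A (V w) x y \<in> S) F"
    if "finite_order A \<xi>" for \<xi>
  proof -
    interpret finite_order A \<xi> by (rule that)
    show ?thesis
    proof (cases "admissible A v \<xi>")
      case True
      \<comment> \<open>The restricted filter may be trivial; the convergence lemma for a fixed
        order allows this.\<close>
      define F' where "F' = inf F (principal {w. V w \<in> llull A \<and> admissible A (V w) \<xi>})"
      have "F' \<le> F"
        unfolding F'_def by (rule inf_le1)
      have "((\<lambda>w. projected_score_wrt A (V w) \<xi> x y) \<longlongrightarrow> projected_score_wrt A v \<xi> x y) F'"
      proof (rule projected_score_wrt_tendsto[OF xy _ _ v True])
        show "((\<lambda>w. V w p) \<longlongrightarrow> v p) F'" if "p \<in> pairs A" for p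
          using \<open>F' \<le> F\<close> V[OF that] by (rule tendsto_mono)
        show "eventually (\<lambda>w. V w \<in> llull A \<and> admissible A (V w) \<xi>) F'"
          by (simp add: F'_def eventually_inf_principal)
      qed
      then have "eventually (\<lambda>w. projected_score_wrt A (V w) \<xi> x y \<in> S) F'"
        using S by (auto simp: projected_score_eq[OF A v xy True] dest: topological_tendstoD)
      then have "eventually (\<lambda>w. V w \<in> llull A \<and> admissible A (V w) \<xi> \<longrightarrow>
          projected_score_wrt A (V w) \<xi> x y \<in> S) F"
        by (simp add: F'_def eventually_inf_principal)
      then show ?thesis
        by (rule eventually_mono) (simp add: projected_score_eq[where \<xi> = \<xi>, OF A _ xy])
    next
      case False
      \<comment> \<open>A negative margin persists near \<open>v\<close>, so nearby matrices do not
        admit \<open>\<xi>\<close> and the implication is vacuous.\<close>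
      then obtain p q where pq: "(p, q) \<in> \<xi>" "indirect_margin A v p q < 0"
        by (auto simp: admissible_iff not_le)
      have "((\<lambda>w. indirect_margin A (V w) p q) \<longlongrightarrow> indirect_margin A v p q) F"
        using A subsetD[OF subset_pairs pq(1)] V by (rule indirect_margin_tendsto)
      then have "eventually (\<lambda>w. indirect_margin A (V w) p q < 0) F"
        using pq(2) by (rule order_tendstoD)
      then show ?thesis
        by (rule eventually_mono) (use pq(1) in \<open>auto simp: admissible_iff\<close>)
    qed
  qed
  moreover have "finite {\<xi>. finite_order A \<xi>}"
    using A by (intro finite_subset[OF _ finite_Pow_iff[THEN iffD2, OF finite_pairs[OF A]]])
      (auto simp: finite_order_def)
  ultimately have "eventually (\<lambda>w. \<forall>\<xi>\<in>{\<xi>. finite_order A \<xi>}. V w \<in> llull A \<and> admissible A (V w) \<xi> \<longrightarrow>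
      projected_score A (V w) x y \<in> S) F"
    by (intro eventually_ball_finite) auto
  with ev show "eventually (\<lambda>w. projected_score A (V w) x y \<in> S) F"
  proof eventually_elim
    case (elim w)
    obtain \<xi> where "admissible A (V w) \<xi>"
      using admissible_exists[OF A] by blast
    moreover from this have "finite_order A \<xi>"
      using A by (simp add: finite_order_def admissible_def)
    ultimately show ?case
      using elim by blast
  qed
qed

text \<open>The filter statement is applied to the identity family along \<open>atin\<close>; the
  subspace of the product topology provides convergence of each coordinate and, its whole space
  being open, membership in \<open>llull A\<close>.\<close>

lemma continuous_map_projected_score:
  assumes "finite A" "(x, y) \<in> pairs A"
  shows "continuous_map (subtopology (powertop_real (pairs A)) (llull A)) euclideanreal
    (\<lambda>v. projected_score A v x y)"
  unfolding continuous_map_atin limitin_canonical_iff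
proof
  let ?X = "subtopology (powertop_real (pairs A)) (llull A)"
  fix v assume v: "v \<in> topspace ?X"
  show "((\<lambda>v. projected_score A v x y) \<longlongrightarrow> projected_score A v x y) (atin ?X v)"
  proof (rule projected_score_tendsto[OF assms])
    show "((\<lambda>w. w p) \<longlongrightarrow> v p) (atin ?X v)" if "p \<in> pairs A" for p
    proof -
      have "continuous_map ?X euclideanreal (\<lambda>w. w p)"
        using that by (intro continuous_map_from_subtopology continuous_map_product_projection)
      then show ?thesis
        using v by (simp add: continuous_map_atin)
    qed
    have "U \<subseteq> llull A" if "openin ?X U" for U
      using openin_subset[OF that] by auto
    then show "eventually (\<lambda>w. w \<in> llull A) (atin ?X v)"
      using openin_topspace[of ?X] v unfolding eventually_atin by blast
    show "v \<in> llull A"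
      using v by simp
  qed
qed

theorem theorem6p1:
  fixes A :: "'a set"
  assumes "finite A" and "A \<noteq> {}"
  shows "(\<forall>(x, y) \<in> pairs A.
            continuous_map (subtopology (powertop_real (pairs A)) (llull A)) euclideanreal
              (\<lambda>v. projected_score A v x y)) \<and>
         (\<forall>x \<in> A.
            continuous_map (subtopology (powertop_real (pairs A)) (llull A)) euclideanreal
              (\<lambda>v. rank_rate A v x))"
proof (intro conjI ballI)
  fix e assume "e \<in> pairs A"
  then show "case e of (x, y) \<Rightarrow> continuous_map (subtopology (powertop_real (pairs A)) (llull A))
      euclideanreal (\<lambda>v. projected_score A v x y)"
    using continuous_map_projected_score[OF assms(1)] by (cases e) simp
next
  fix x assume "x \<in> A"
  then show "continuous_map (subtopology (powertop_real (pairs A)) (llull A)) euclideanreal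
      (\<lambda>v. rank_rate A v x)"
    unfolding rank_rate_def using assms(1)
    by (intro continuous_map_diff continuous_map_sum continuous_map_projected_score)
      (auto simp: pairs_def)
qed

end
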